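(* Let $\mathbb{E}$ be any finitely complete category. The following conditions are equivalent: 1) there are cocartesian maps with respect to $(\;)_0$ in $PrO\,\mathbb{E}$ (resp. in $Equ\,\mathbb{E}$) above any split epimorphism in $\mathbb{E}$ and with any domain in $PrO\,\mathbb{E}$ (resp. in $Equ\,\mathbb{E}$); 2) there are suprema $R\vee S$ in $PrO\,\mathbb{E}$ (resp. in $Equ\,\mathbb{E}$), i.e. among the preorders (resp. the equivalence relations) on the ground object, of any pair $(R,S)$ of an equivalence relation $R$ and a preorder $S$ on the same object (resp. of any pair of equivalence relations on the same object). When, in addition, the category $\mathbb{E}$ is regular, the following conditions are equivalent: 1) there are cocartesian maps with respect to $(\;)_0$ in $PrO\,\mathbb{E}$ (resp. in $Equ\,\mathbb{E}$) above any regular epimorphism in $\mathbb{E}$ and with any domain in $PrO\,\mathbb{E}$ (resp. in $Equ\,\mathbb{E}$); 2) there are suprema $R\vee S$ in $PrO\,\mathbb{E}$ (resp. in $Equ\,\mathbb{E}$) of any pair $(R,S)$ of an equivalence relation and a preorder on the same object (resp. of any pair of equivalence relations on the same object).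
   Context: A relation on $X$ is (a class up to isomorphism of) a subobject $R\rightarrowtail X\times X$; relations are ordered by inclusion. $\Delta_X$ is the diagonal. A relation $R$ is reflexive if $\Delta_X\subset R$, symmetric if $R^{op}\subset R$; transitivity is meant internally (equivalently, $\mathrm{Hom}(A,R)$ is a transitive relation on $\mathrm{Hom}(A,X)$ for every object $A$; in a regular category, $R\circ R\subset R$). A preorder is a reflexive transitive relation; an equivalence relation is a symmetric preorder. For $f:X\to Y$ and a relation $S$ on $Y$, the inverse image $f^{-1}(S)$ is the pullback of $S\rightarrowtail Y\times Y$ along $f\times f$. $Ref\,\mathbb{E}$ is the category whose objects are pairs (object $X$, reflexive relation $R$ on $X$) and in which a morphism $R\to S$ above $f:X\to Y$ exists (and is unique) iff $R\subset f^{-1}(S)$; $(\;)_0$ is the forgetful functor to $\mathbb{E}$ sending $R$ to its ground object $X$. $PrO\,\mathbb{E}$ and $Equ\,\mathbb{E}$ are its full subcategories of preorders and of equivalence relations, with the restrictions of $(\;)_0$. Given a functor $U:\mathbb{C}\to\mathbb{D}$, a map $f:X\to Z$ of $\mathbb{C}$ is cocartesian with respect to $U$ when, for every map $\phi:X\to W$ with $U(\phi)=U(f)$, there is a unique $\psi:Z\to W$ with $\psi f=\phi$ and $U(\psi)=1_{U(Z)}$. "A cocartesian map above $f:X\to Y$ with domain $T$" ($T$ on $X$) is a cocartesian map with domain $T$ whose image by $(\;)_0$ is $f$. A regular category is a finitely complete category in which every map factors as a regular epimorphism followed by a monomorphism, regular epimorphisms being stable under pullback. *)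

theory Defs
  imports "HOL-Algebra.Order"
begin

section \<open>Categories and functors\<close>

text \<open>The composite \<open>g \<cdot> f\<close> (first \<open>f\<close>, then \<open>g\<close>) is meaningful only if \<open>tgt f = src g\<close>.\<close>

record ('o, 'a) cat =
  obj :: "'o set"
  arr :: "'a set"
  src :: "'a \<Rightarrow> 'o"
  tgt :: "'a \<Rightarrow> 'o"
  idn :: "'o \<Rightarrow> 'a"
  cmp :: "'a \<Rightarrow> 'a \<Rightarrow> 'a"  (infixr "\<cdot>\<index>" 70)

definition hom :: "('o, 'a) cat \<Rightarrow> 'o \<Rightarrow> 'o \<Rightarrow> 'a set" where
  "hom C X Y = {f \<in> arr C. src C f = X \<and> tgt C f = Y}"

locale category =
  fixes C :: "('o, 'a) cat" (structure)
  assumes src_obj: "f \<in> arr C \<Longrightarrow> src C f \<in> obj C"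
    and tgt_obj: "f \<in> arr C \<Longrightarrow> tgt C f \<in> obj C"
    and idn_hom: "X \<in> obj C \<Longrightarrow> idn C X \<in> hom C X X"
    and cmp_hom: "f \<in> hom C X Y \<Longrightarrow> g \<in> hom C Y Z \<Longrightarrow> g \<cdot> f \<in> hom C X Z"
    and cmp_idn: "f \<in> hom C X Y \<Longrightarrow> f \<cdot> idn C X = f"
    and idn_cmp: "f \<in> hom C X Y \<Longrightarrow> idn C Y \<cdot> f = f"
    and cmp_assoc: "f \<in> hom C W X \<Longrightarrow> g \<in> hom C X Y \<Longrightarrow> h \<in> hom C Y Z \<Longrightarrow>
      (h \<cdot> g) \<cdot> f = h \<cdot> (g \<cdot> f)"

record ('o, 'a, 'p, 'b) fctr =
  fobj :: "'o \<Rightarrow> 'p"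
  farr :: "'a \<Rightarrow> 'b"

definition is_functor ::
    "('o, 'a) cat \<Rightarrow> ('p, 'b) cat \<Rightarrow> ('o, 'a, 'p, 'b) fctr \<Rightarrow> bool" where
  "is_functor C D F \<longleftrightarrow> category C \<and> category D \<and>
    (\<forall>X\<in>obj C. fobj F X \<in> obj D) \<and>
    (\<forall>f\<in>arr C. farr F f \<in> hom D (fobj F (src C f)) (fobj F (tgt C f))) \<and>
    (\<forall>X\<in>obj C. farr F (idn C X) = idn D (fobj F X)) \<and>
    (\<forall>f\<in>arr C. \<forall>g\<in>arr C. tgt C f = src C g \<longrightarrow>
      farr F (g \<cdot>\<^bsub>C\<^esub> f) = farr F g \<cdot>\<^bsub>D\<^esub> farr F f)"

definition full_subcat :: "('o, 'a) cat \<Rightarrow> ('o \<Rightarrow> bool) \<Rightarrow> ('o, 'a) cat" where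
  "full_subcat C P =
    C\<lparr>obj := {X \<in> obj C. P X}, arr := {f \<in> arr C. P (src C f) \<and> P (tgt C f)}\<rparr>"

definition cocartesian ::
    "('o, 'a) cat \<Rightarrow> ('p, 'b) cat \<Rightarrow> ('o, 'a, 'p, 'b) fctr \<Rightarrow> 'a \<Rightarrow> bool" where
  "cocartesian C D U f \<longleftrightarrow> f \<in> arr C \<and>
    (\<forall>\<phi>\<in>arr C. src C \<phi> = src C f \<and> farr U \<phi> = farr U f \<longrightarrow>
      (\<exists>!\<psi>. \<psi> \<in> hom C (tgt C f) (tgt C \<phi>) \<and> \<psi> \<cdot>\<^bsub>C\<^esub> f = \<phi> \<and>
        farr U \<psi> = idn D (fobj U (tgt C f))))"


section \<open>Finite limits and regular categories\<close>

definition is_cone ::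
    "('j, 'k) cat \<Rightarrow> ('o, 'a) cat \<Rightarrow> ('j, 'k, 'o, 'a) fctr \<Rightarrow> 'o \<Rightarrow> ('j \<Rightarrow> 'a) \<Rightarrow> bool" where
  "is_cone J C F L \<pi> \<longleftrightarrow> L \<in> obj C \<and> (\<forall>j\<in>obj J. \<pi> j \<in> hom C L (fobj F j)) \<and>
    (\<forall>u\<in>arr J. farr F u \<cdot>\<^bsub>C\<^esub> \<pi> (src J u) = \<pi> (tgt J u))"

definition is_limit ::
    "('j, 'k) cat \<Rightarrow> ('o, 'a) cat \<Rightarrow> ('j, 'k, 'o, 'a) fctr \<Rightarrow> 'o \<Rightarrow> ('j \<Rightarrow> 'a) \<Rightarrow> bool" where
  "is_limit J C F L \<pi> \<longleftrightarrow> is_cone J C F L \<pi> \<and>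
    (\<forall>M \<mu>. is_cone J C F M \<mu> \<longrightarrow>
      (\<exists>!h. h \<in> hom C M L \<and> (\<forall>j\<in>obj J. \<pi> j \<cdot>\<^bsub>C\<^esub> h = \<mu> j)))"

text \<open>Every finite category is isomorphic to one whose objects and arrows are natural numbers,
  so it suffices to quantify over those.\<close>

locale finitely_complete = category +
  assumes finite_limits:
    "\<And>(J :: (nat, nat) cat) F. finite (obj J) \<Longrightarrow> finite (arr J) \<Longrightarrow> is_functor J C F \<Longrightarrow>
      \<exists>L \<pi>. is_limit J C F L \<pi>"

definition is_product :: "('o, 'a) cat \<Rightarrow> 'o \<Rightarrow> 'o \<Rightarrow> 'o \<Rightarrow> 'a \<Rightarrow> 'a \<Rightarrow> bool" where
  "is_product C X Y P p q \<longleftrightarrow> P \<in> obj C \<and> p \<in> hom C P X \<and> q \<in> hom C P Y \<and>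
    (\<forall>A\<in>obj C. \<forall>a\<in>hom C A X. \<forall>b\<in>hom C A Y.
      \<exists>!h. h \<in> hom C A P \<and> p \<cdot>\<^bsub>C\<^esub> h = a \<and> q \<cdot>\<^bsub>C\<^esub> h = b)"

text \<open>\<open>p\<close> is the pullback of \<open>g\<close> along \<open>f\<close>, and \<open>q\<close> the pullback of \<open>f\<close> along \<open>g\<close>.\<close>

definition is_pullback ::
    "('o, 'a) cat \<Rightarrow> 'a \<Rightarrow> 'a \<Rightarrow> 'o \<Rightarrow> 'a \<Rightarrow> 'a \<Rightarrow> bool" where
  "is_pullback C f g P p q \<longleftrightarrow> f \<in> arr C \<and> g \<in> arr C \<and> tgt C f = tgt C g \<and>
    P \<in> obj C \<and> p \<in> hom C P (src C f) \<and> q \<in> hom C P (src C g) \<and>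
    f \<cdot>\<^bsub>C\<^esub> p = g \<cdot>\<^bsub>C\<^esub> q \<and>
    (\<forall>A\<in>obj C. \<forall>a\<in>hom C A (src C f). \<forall>b\<in>hom C A (src C g).
      f \<cdot>\<^bsub>C\<^esub> a = g \<cdot>\<^bsub>C\<^esub> b \<longrightarrow>
      (\<exists>!h. h \<in> hom C A P \<and> p \<cdot>\<^bsub>C\<^esub> h = a \<and> q \<cdot>\<^bsub>C\<^esub> h = b))"

definition is_mono :: "('o, 'a) cat \<Rightarrow> 'a \<Rightarrow> bool" where
  "is_mono C m \<longleftrightarrow> m \<in> arr C \<and>
    (\<forall>A\<in>obj C. \<forall>u\<in>hom C A (src C m). \<forall>v\<in>hom C A (src C m).
      m \<cdot>\<^bsub>C\<^esub> u = m \<cdot>\<^bsub>C\<^esub> v \<longrightarrow> u = v)"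

definition is_iso :: "('o, 'a) cat \<Rightarrow> 'a \<Rightarrow> bool" where
  "is_iso C i \<longleftrightarrow> i \<in> arr C \<and>
    (\<exists>j\<in>hom C (tgt C i) (src C i).
      j \<cdot>\<^bsub>C\<^esub> i = idn C (src C i) \<and> i \<cdot>\<^bsub>C\<^esub> j = idn C (tgt C i))"

definition split_epi :: "('o, 'a) cat \<Rightarrow> 'a \<Rightarrow> bool" where
  "split_epi C f \<longleftrightarrow> f \<in> arr C \<and>
    (\<exists>s\<in>hom C (tgt C f) (src C f). f \<cdot>\<^bsub>C\<^esub> s = idn C (tgt C f))"

definition is_coequalizer :: "('o, 'a) cat \<Rightarrow> 'a \<Rightarrow> 'a \<Rightarrow> 'a \<Rightarrow> bool" where
  "is_coequalizer C u v f \<longleftrightarrow> f \<in> arr C \<and>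
    (\<exists>A\<in>obj C. u \<in> hom C A (src C f) \<and> v \<in> hom C A (src C f)) \<and>
    f \<cdot>\<^bsub>C\<^esub> u = f \<cdot>\<^bsub>C\<^esub> v \<and>
    (\<forall>W\<in>obj C. \<forall>g\<in>hom C (src C f) W. g \<cdot>\<^bsub>C\<^esub> u = g \<cdot>\<^bsub>C\<^esub> v \<longrightarrow>
      (\<exists>!h. h \<in> hom C (tgt C f) W \<and> h \<cdot>\<^bsub>C\<^esub> f = g))"

definition regular_epi :: "('o, 'a) cat \<Rightarrow> 'a \<Rightarrow> bool" where
  "regular_epi C f \<longleftrightarrow> (\<exists>u v. is_coequalizer C u v f)"

locale regular_category = finitely_complete +
  assumes regular_epi_mono_factorization:
    "f \<in> arr C \<Longrightarrow> \<exists>e m. regular_epi C e \<and> is_mono C m \<and> tgt C e = src C m \<and> f = m \<cdot> e"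
    and regular_epi_pullback: "regular_epi C f \<Longrightarrow> is_pullback C g f P p q \<Longrightarrow> regular_epi C p"


section \<open>Relations\<close>

text \<open>A subobject of \<open>P\<close> is represented by the set of all monomorphisms into \<open>P\<close> in one
  isomorphism class.\<close>

definition subobject_class :: "('o, 'a) cat \<Rightarrow> 'a \<Rightarrow> 'a set" where
  "subobject_class C m = {n. is_mono C n \<and> tgt C n = tgt C m \<and>
    (\<exists>i\<in>hom C (src C n) (src C m). is_iso C i \<and> m \<cdot>\<^bsub>C\<^esub> i = n)}"

definition subobjects :: "('o, 'a) cat \<Rightarrow> 'o \<Rightarrow> 'a set set" where
  "subobjects C P = {subobject_class C m | m. is_mono C m \<and> tgt C m = P}"

definition subobject_le :: "('o, 'a) cat \<Rightarrow> 'a set \<Rightarrow> 'a set \<Rightarrow> bool" where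
  "subobject_le C R S \<longleftrightarrow>
    (\<exists>r\<in>R. \<exists>s\<in>S. \<exists>h\<in>hom C (src C r) (src C s). s \<cdot>\<^bsub>C\<^esub> h = r)"

text \<open>A fixed choice of \<open>X \<times> X\<close> with its two projections.\<close>

definition square :: "('o, 'a) cat \<Rightarrow> 'o \<Rightarrow> 'o \<times> 'a \<times> 'a" where
  "square C X = (SOME (P, p, q). is_product C X X P p q)"

definition sq :: "('o, 'a) cat \<Rightarrow> 'o \<Rightarrow> 'o" where
  "sq C X = fst (square C X)"

definition pr0 :: "('o, 'a) cat \<Rightarrow> 'o \<Rightarrow> 'a" where
  "pr0 C X = fst (snd (square C X))"

definition pr1 :: "('o, 'a) cat \<Rightarrow> 'o \<Rightarrow> 'a" where
  "pr1 C X = snd (snd (square C X))"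

definition pairing :: "('o, 'a) cat \<Rightarrow> 'o \<Rightarrow> 'a \<Rightarrow> 'a \<Rightarrow> 'a" where
  "pairing C X a b = (THE h. h \<in> hom C (src C a) (sq C X) \<and>
    pr0 C X \<cdot>\<^bsub>C\<^esub> h = a \<and> pr1 C X \<cdot>\<^bsub>C\<^esub> h = b)"

definition sq_map :: "('o, 'a) cat \<Rightarrow> 'a \<Rightarrow> 'a" where
  "sq_map C f = pairing C (tgt C f)
    (f \<cdot>\<^bsub>C\<^esub> pr0 C (src C f)) (f \<cdot>\<^bsub>C\<^esub> pr1 C (src C f))"

definition relations :: "('o, 'a) cat \<Rightarrow> 'o \<Rightarrow> 'a set set" where
  "relations C X = subobjects C (sq C X)"

definition diagonal :: "('o, 'a) cat \<Rightarrow> 'o \<Rightarrow> 'a set" where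
  "diagonal C X = subobject_class C (pairing C X (idn C X) (idn C X))"

definition opposite :: "('o, 'a) cat \<Rightarrow> 'o \<Rightarrow> 'a set \<Rightarrow> 'a set" where
  "opposite C X R = (\<lambda>r. pairing C X (pr1 C X) (pr0 C X) \<cdot>\<^bsub>C\<^esub> r) ` R"

text \<open>All pullbacks along \<open>f \<times> f\<close> of all representatives of \<open>S\<close>; these form a single
  isomorphism class of monomorphisms.\<close>

definition inverse_image :: "('o, 'a) cat \<Rightarrow> 'a \<Rightarrow> 'a set \<Rightarrow> 'a set" where
  "inverse_image C f S = {r. \<exists>s\<in>S. \<exists>P q. is_pullback C (sq_map C f) s P r q}"

text \<open>The relation induced by \<open>Hom(A, R)\<close> on \<open>Hom(A, X)\<close>; internal transitivity of \<open>R\<close> means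
  that it is transitive for every \<open>A\<close>.\<close>

definition hom_relation :: "('o, 'a) cat \<Rightarrow> 'o \<Rightarrow> 'a set \<Rightarrow> 'o \<Rightarrow> ('a \<times> 'a) set" where
  "hom_relation C X R A =
    {(pr0 C X \<cdot>\<^bsub>C\<^esub> r \<cdot>\<^bsub>C\<^esub> h, pr1 C X \<cdot>\<^bsub>C\<^esub> r \<cdot>\<^bsub>C\<^esub> h) | r h.
      r \<in> R \<and> h \<in> hom C A (src C r)}"

definition reflexive_rels :: "('o, 'a) cat \<Rightarrow> 'o \<Rightarrow> 'a set set" where
  "reflexive_rels C X = {R \<in> relations C X. subobject_le C (diagonal C X) R}"

definition symmetric_rels :: "('o, 'a) cat \<Rightarrow> 'o \<Rightarrow> 'a set set" where
  "symmetric_rels C X = {R \<in> relations C X. subobject_le C (opposite C X R) R}"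

definition transitive_rels :: "('o, 'a) cat \<Rightarrow> 'o \<Rightarrow> 'a set set" where
  "transitive_rels C X = {R \<in> relations C X. \<forall>A\<in>obj C. trans (hom_relation C X R A)}"

definition preorder_rels :: "('o, 'a) cat \<Rightarrow> 'o \<Rightarrow> 'a set set" where
  "preorder_rels C X = reflexive_rels C X \<inter> transitive_rels C X"

definition equivalence_rels :: "('o, 'a) cat \<Rightarrow> 'o \<Rightarrow> 'a set set" where
  "equivalence_rels C X = preorder_rels C X \<inter> symmetric_rels C X"

definition has_supremum :: "('o, 'a) cat \<Rightarrow> 'a set set \<Rightarrow> 'a set \<Rightarrow> 'a set \<Rightarrow> bool" where
  "has_supremum C \<R> R S \<longleftrightarrow>
    (let L = \<lparr>carrier = \<R>, eq = (=), le = subobject_le C\<rparr>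
     in \<exists>Q. least L Q (Upper L {R, S}))"


section \<open>Categories of relations\<close>

text \<open>An arrow is a triple consisting of its domain, the underlying arrow of \<open>C\<close>, and its
  codomain.\<close>

type_synonym ('o, 'a) rel_obj = "'o \<times> 'a set"
type_synonym ('o, 'a) rel_arr = "('o, 'a) rel_obj \<times> 'a \<times> ('o, 'a) rel_obj"

definition Ref :: "('o, 'a) cat \<Rightarrow> (('o, 'a) rel_obj, ('o, 'a) rel_arr) cat" where
  "Ref C = \<lparr>
    obj = {(X, R). X \<in> obj C \<and> R \<in> reflexive_rels C X},
    arr = {((X, R), f, (Y, S)) | X R f Y S.
      X \<in> obj C \<and> R \<in> reflexive_rels C X \<and> Y \<in> obj C \<and> S \<in> reflexive_rels C Y \<and>
      f \<in> hom C X Y \<and> subobject_le C R (inverse_image C f S)},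
    src = (\<lambda>(x, f, y). x),
    tgt = (\<lambda>(x, f, y). y),
    idn = (\<lambda>x. (x, idn C (fst x), x)),
    cmp = (\<lambda>(y', g, z) (x, f, y). (x, g \<cdot>\<^bsub>C\<^esub> f, z))\<rparr>"

definition PrO :: "('o, 'a) cat \<Rightarrow> (('o, 'a) rel_obj, ('o, 'a) rel_arr) cat" where
  "PrO C = full_subcat (Ref C) (\<lambda>(X, R). R \<in> preorder_rels C X)"

definition Equ :: "('o, 'a) cat \<Rightarrow> (('o, 'a) rel_obj, ('o, 'a) rel_arr) cat" where
  "Equ C = full_subcat (Ref C) (\<lambda>(X, R). R \<in> equivalence_rels C X)"

text \<open>The underlying maps of the functor \<open>( )\<^sub>0\<close>, on \<open>Ref C\<close> and its subcategories.\<close>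

definition ground :: "(('o, 'a) rel_obj, ('o, 'a) rel_arr, 'o, 'a) fctr" where
  "ground = \<lparr>fobj = fst, farr = (\<lambda>(x, f, y). f)\<rparr>"

definition has_cocartesian_above ::
    "('p, 'b) cat \<Rightarrow> ('o, 'a) cat \<Rightarrow> ('p, 'b, 'o, 'a) fctr \<Rightarrow> 'a \<Rightarrow> 'p \<Rightarrow> bool" where
  "has_cocartesian_above D C U f T \<longleftrightarrow>
    (\<exists>k. cocartesian D C U k \<and> src D k = T \<and> farr U k = f)"

end

theory Submission
  imports Defs
begin

text \<open>
  Everything is reduced to elementwise reasoning. A relation \<open>R\<close> on \<open>X\<close> is determined by the
  relations that it induces on the sets \<open>Hom(A, X)\<close>: inclusion of relations is inclusion of
  the induced ones at every stage \<open>A\<close> (\<open>subobject_le_iff\<close>, \<open>subobject_le_antisym\<close>), and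
  reflexivity, transitivity, symmetry and inverse images have their usual set-theoretic meaning
  there. Write \<open>\<K>\<close> for either preorders or equivalence relations. As there is at most one
  morphism of relations above a given map, a cocartesian map above \<open>f : X \<rightarrow> Y\<close> with domain \<open>T\<close> is a
  relation \<open>S \<in> \<K>\<close> on \<open>Y\<close> with \<open>S \<subseteq> W \<longleftrightarrow> T \<subseteq> f\<^sup>-\<^sup>1(W)\<close> for all \<open>W \<in> \<K>\<close>
  (\<open>has_cocartesian_above_iff\<close>).

  Suprema from cocartesian maps: let \<open>d\<^sub>0, d\<^sub>1 : R \<rightarrow> X\<close> be the two legs of an equivalence
  relation \<open>R\<close>. The leg \<open>d\<^sub>1\<close> is split by reflexivity. The direct image along \<open>d\<^sub>1\<close> of
  \<open>d\<^sub>0\<^sup>-\<^sup>1(S)\<close> lies below \<open>W\<close> iff \<open>x R y\<close>, \<open>x' R y'\<close> and \<open>x S x'\<close> always imply \<open>y W y'\<close>. For a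
  preorder \<open>W\<close> this holds iff \<open>W\<close> contains both \<open>R\<close> and \<open>S\<close>: in one direction by composing
  \<open>y R x S x' R y'\<close>, in the other by taking \<open>x = y\<close> and \<open>x' = y'\<close>, or \<open>x = y = x'\<close>. So this
  direct image is \<open>R \<or> S\<close>.

  Cocartesian maps from suprema: let \<open>Q\<close> be the supremum of \<open>T\<close> and the kernel equivalence
  relation of \<open>f\<close>. Every \<open>f\<^sup>-\<^sup>1(W)\<close> with \<open>W\<close> reflexive contains the kernel, so \<open>T \<subseteq> f\<^sup>-\<^sup>1(W)\<close> iff
  \<open>Q \<subseteq> f\<^sup>-\<^sup>1(W)\<close>. It remains to write \<open>Q\<close> as \<open>f\<^sup>-\<^sup>1(S)\<close> with \<open>S \<in> \<K>\<close> and to see that \<open>f\<^sup>-\<^sup>1\<close>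
  reflects inclusions (\<open>cocartesian_above_if_supremum\<close>). When \<open>f\<close> has a section \<open>s\<close>, one takes
  \<open>S = s\<^sup>-\<^sup>1(Q)\<close>; it works because \<open>x\<close> and \<open>s (f x)\<close> are related both ways by the kernel, hence by
  \<open>Q\<close>. When \<open>f\<close> is a regular epimorphism of a regular category, \<open>S\<close> is the image of
  \<open>Q\<close> under \<open>f \<times> f\<close>; elements of \<open>Y\<close> lift to \<open>X\<close> after restriction along a regular epimorphism
  (\<open>local_lift\<close>) and membership in a relation can be tested after such a restriction
  (\<open>hom_relation_descend\<close>), so that the set-theoretic argument goes through. Finally, a split
  epimorphism is regular, which makes the first condition of the regular case imply that of the
  split case.
\<close>


section \<open>Composition and subobjects\<close>

context category
begin

lemma homD:
  assumes "f \<in> hom C X Y"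
  shows "f \<in> arr C" "src C f = X" "tgt C f = Y" "X \<in> obj C" "Y \<in> obj C"
  using assms src_obj tgt_obj by (auto simp: hom_def)

lemma arr_hom: "f \<in> arr C \<Longrightarrow> f \<in> hom C (src C f) (tgt C f)"
  by (simp add: hom_def)

lemma cmp_arr:
  assumes "f \<in> arr C" "g \<in> arr C" "tgt C f = src C g"
  shows "g \<cdot> f \<in> arr C" "src C (g \<cdot> f) = src C f" "tgt C (g \<cdot> f) = tgt C g"
  using cmp_hom[of f "src C f" "tgt C f" g "tgt C g"] assms by (auto simp: hom_def)

lemma assoc:
  assumes "f \<in> arr C" "g \<in> arr C" "h \<in> arr C" "tgt C f = src C g" "tgt C g = src C h"
  shows "(h \<cdot> g) \<cdot> f = h \<cdot> (g \<cdot> f)"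
  using cmp_assoc[of f "src C f" "src C g" g "src C h" h "tgt C h"] assms by (auto simp: hom_def)

lemma idn_arr:
  assumes "X \<in> obj C"
  shows "idn C X \<in> arr C" "src C (idn C X) = X" "tgt C (idn C X) = X"
  using idn_hom[OF assms] by (auto simp: hom_def)

lemma cmp_idn_arr: "f \<in> arr C \<Longrightarrow> src C f = X \<Longrightarrow> f \<cdot> idn C X = f"
  using cmp_idn[of f X "tgt C f"] by (simp add: hom_def)

lemma idn_cmp_arr: "f \<in> arr C \<Longrightarrow> tgt C f = X \<Longrightarrow> idn C X \<cdot> f = f"
  using idn_cmp[of f "src C f" X] by (simp add: hom_def)

lemma cmp_eqD:
  assumes "g \<cdot> f = k" "f \<in> hom C X Y" "g \<in> hom C Y Z" "h \<in> hom C W X"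
  shows "g \<cdot> (f \<cdot> h) = k \<cdot> h"
  using cmp_assoc[of h W X f Y g Z] assms by simp

lemmas cat_simps = src_obj tgt_obj cmp_arr assoc idn_arr cmp_idn_arr idn_cmp_arr

lemma is_monoI:
  assumes "m \<in> hom C P Q"
    and "\<And>A u v. u \<in> hom C A P \<Longrightarrow> v \<in> hom C A P \<Longrightarrow> m \<cdot> u = m \<cdot> v \<Longrightarrow> u = v"
  shows "is_mono C m"
  using assms by (auto simp: is_mono_def hom_def)

lemma is_monoD:
  assumes "is_mono C m" "u \<in> hom C A (src C m)" "v \<in> hom C A (src C m)" "m \<cdot> u = m \<cdot> v"
  shows "u = v"
  using assms homD(4) unfolding is_mono_def by blast

lemma mono_hom: "is_mono C m \<Longrightarrow> m \<in> hom C (src C m) (tgt C m)"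
  by (simp add: is_mono_def hom_def)

text \<open>Mutual factorisation needs no isomorphism to be exhibited: for monomorphisms the two
  factors are automatically inverse to each other.\<close>

lemma mem_subobject_class_iff:
  assumes m: "is_mono C m"
  shows "n \<in> subobject_class C m \<longleftrightarrow> is_mono C n \<and> tgt C n = tgt C m \<and>
    (\<exists>u\<in>hom C (src C n) (src C m). m \<cdot> u = n) \<and> (\<exists>v\<in>hom C (src C m) (src C n). n \<cdot> v = m)"
    (is "?L \<longleftrightarrow> ?R")
proof
  assume ?L
  then obtain i where n: "is_mono C n" "tgt C n = tgt C m"
    and i: "i \<in> hom C (src C n) (src C m)" "is_iso C i" "m \<cdot> i = n"
    by (auto simp: subobject_class_def)
  then obtain j where j: "j \<in> hom C (src C m) (src C n)" "i \<cdot> j = idn C (src C m)"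
    by (auto simp: is_iso_def hom_def)
  have "n \<cdot> j = m \<cdot> (i \<cdot> j)"
    by (rule cmp_eqD[OF i(3,1) mono_hom[OF m] j(1), symmetric])
  also have "\<dots> = m"
    using j(2) mono_hom[OF m] by (simp add: hom_def cat_simps)
  finally show ?R
    using n i j(1) by blast
next
  assume ?R
  then obtain u v where n: "is_mono C n" "tgt C n = tgt C m"
    and u: "u \<in> hom C (src C n) (src C m)" "m \<cdot> u = n"
    and v: "v \<in> hom C (src C m) (src C n)" "n \<cdot> v = m"
    by blast
  note mh = mono_hom[OF m] and nh = mono_hom[OF n(1)]
  have "m \<cdot> (u \<cdot> v) = m \<cdot> idn C (src C m)"
    using cmp_eqD[OF u(2,1) mh v(1)] v(2) cmp_idn[OF mh] by simp
  then have uv: "u \<cdot> v = idn C (src C m)"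
    by (rule is_monoD[OF m cmp_hom[OF v(1) u(1)] idn_hom[OF homD(4)[OF mh]]])
  have "n \<cdot> (v \<cdot> u) = n \<cdot> idn C (src C n)"
    using cmp_eqD[OF v(2,1) _ u(1)] nh n(2) u(2) cmp_idn[OF nh] by simp
  then have "v \<cdot> u = idn C (src C n)"
    by (rule is_monoD[OF n(1) cmp_hom[OF u(1) v(1)] idn_hom[OF homD(4)[OF nh]]])
  then have "is_iso C u"
    using uv homD(1)[OF u(1)] v(1) unfolding is_iso_def homD(2,3)[OF u(1)] by blast
  then show ?L
    using n u by (auto simp: subobject_class_def)
qed

lemma mono_mem_subobject_class:
  assumes "is_mono C m" shows "m \<in> subobject_class C m"
proof -
  have "m \<in> hom C (src C m) (tgt C m)"
    by (rule mono_hom[OF assms])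
  then show ?thesis
    using assms homD(4) idn_hom cmp_idn unfolding mem_subobject_class_iff[OF assms] by blast
qed

lemma split_epi_regular_epi:
  assumes "split_epi C f" shows "regular_epi C f"
proof -
  obtain s where f: "f \<in> arr C" and s: "s \<in> hom C (tgt C f) (src C f)" "f \<cdot> s = idn C (tgt C f)"
    using assms by (auto simp: split_epi_def)
  \<comment> \<open>the factor of \<open>g\<close> through \<open>f\<close> is \<open>g \<cdot> s\<close>\<close>
  have "is_coequalizer C (s \<cdot> f) (idn C (src C f)) f"
    unfolding is_coequalizer_def
  proof (intro conjI ballI impI)
    show "\<exists>A\<in>obj C. s \<cdot> f \<in> hom C A (src C f) \<and> idn C (src C f) \<in> hom C A (src C f)"
      using f s(1) by (intro bexI[of _ "src C f"]) (auto simp: hom_def cat_simps)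
    have "f \<cdot> s \<cdot> f = (f \<cdot> s) \<cdot> f"
      using f s(1) by (simp add: hom_def cat_simps)
    then show "f \<cdot> s \<cdot> f = f \<cdot> idn C (src C f)"
      using f s by (simp add: cat_simps)
    fix W g assume "W \<in> obj C" and g: "g \<in> hom C (src C f) W"
      and eq: "g \<cdot> s \<cdot> f = g \<cdot> idn C (src C f)"
    show "\<exists>!h. h \<in> hom C (tgt C f) W \<and> h \<cdot> f = g"
    proof (rule ex1I[of _ "g \<cdot> s"])
      show "g \<cdot> s \<in> hom C (tgt C f) W \<and> (g \<cdot> s) \<cdot> f = g"
        using f s(1) g eq by (auto simp: hom_def cat_simps)
      fix h assume h: "h \<in> hom C (tgt C f) W \<and> h \<cdot> f = g"
      then have "g \<cdot> s = h \<cdot> (f \<cdot> s)"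
        using f s(1) by (auto simp: hom_def cat_simps)
      then show "h = g \<cdot> s"
        using h s(2) by (auto simp: hom_def cat_simps)
    qed
  qed (use f in simp)
  then show ?thesis
    unfolding regular_epi_def by blast
qed

end


section \<open>Products and pullbacks from finite limits\<close>

context finitely_complete
begin

lemma product_exists:
  assumes X: "X \<in> obj C" and Y: "Y \<in> obj C"
  shows "\<exists>P p q. is_product C X Y P p q"
proof -
  define J :: "(nat, nat) cat" where
    "J = \<lparr>obj = {0, 1}, arr = {0, 1}, src = (\<lambda>i. i), tgt = (\<lambda>i. i), idn = (\<lambda>i. i),
      cmp = (\<lambda>g f. f)\<rparr>"
  define F where "F = \<lparr>fobj = (\<lambda>i. if i = (0::nat) then X else Y),
      farr = (\<lambda>i. if i = (0::nat) then idn C X else idn C Y)\<rparr>"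
  have "category J"
    by unfold_locales (auto simp: J_def hom_def)
  then have "is_functor J C F"
    using X Y category_axioms by (auto simp: is_functor_def J_def F_def hom_def cat_simps)
  then obtain L \<pi> where L: "is_limit J C F L \<pi>"
    using finite_limits[of J F] by (auto simp: J_def)
  have cone: "is_cone J C F M \<mu> \<longleftrightarrow> M \<in> obj C \<and> \<mu> 0 \<in> hom C M X \<and> \<mu> 1 \<in> hom C M Y" for M \<mu>
    by (auto simp: is_cone_def J_def F_def idn_cmp)
  have "is_product C X Y L (\<pi> 0) (\<pi> 1)"
    unfolding is_product_def
  proof (intro conjI ballI)
    fix A a b assume "A \<in> obj C" "a \<in> hom C A X" "b \<in> hom C A Y"
    then have "is_cone J C F A (\<lambda>i. if i = 0 then a else b)"
      by (simp add: cone)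
    then have "\<exists>!h. h \<in> hom C A L \<and> (\<forall>j\<in>obj J. \<pi> j \<cdot> h = (if j = 0 then a else b))"
      using L by (simp add: is_limit_def)
    then show "\<exists>!h. h \<in> hom C A L \<and> \<pi> 0 \<cdot> h = a \<and> \<pi> 1 \<cdot> h = b"
      by (simp add: J_def)
  qed (use L cone in \<open>auto simp: is_limit_def\<close>)
  then show ?thesis
    by blast
qed

lemma pullback_exists:
  assumes f: "f \<in> hom C X Z" and g: "g \<in> hom C Y Z"
  shows "\<exists>P p q. is_pullback C f g P p q"
proof -
  note o = homD(4,5)[OF f] homD(4)[OF g]
  \<comment> \<open>the objects \<open>0, 1, 2\<close> are \<open>X, Y, Z\<close>, with identities \<open>0, 1, 2\<close>; the arrows \<open>3\<close> and \<open>4\<close>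
    are \<open>f\<close> and \<open>g\<close>\<close>
  define J :: "(nat, nat) cat" where
    "J = \<lparr>obj = {0, 1, 2}, arr = {0, 1, 2, 3, 4},
      src = (\<lambda>u. if u = 3 then 0 else if u = 4 then 1 else u),
      tgt = (\<lambda>u. if u = 3 then 2 else if u = 4 then 2 else u), idn = (\<lambda>i. i),
      cmp = (\<lambda>v u. if u < 3 then v else u)\<rparr>"
  define F where "F = \<lparr>fobj = (\<lambda>i. if i = (0::nat) then X else if i = 1 then Y else Z),
      farr = (\<lambda>u. if u = (0::nat) then idn C X else if u = 1 then idn C Y
        else if u = 2 then idn C Z else if u = 3 then f else g)\<rparr>"
  have "category J"
    by unfold_locales (auto simp: J_def hom_def split: if_splits)
  then have "is_functor J C F"
    using f g o category_axioms unfolding is_functor_def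
    by (auto simp: J_def F_def hom_def cat_simps)
  then obtain L \<pi> where L: "is_limit J C F L \<pi>"
    using finite_limits[of J F] by (auto simp: J_def)
  have cone: "is_cone J C F M \<mu> \<longleftrightarrow> M \<in> obj C \<and> \<mu> 0 \<in> hom C M X \<and> \<mu> 1 \<in> hom C M Y \<and>
      \<mu> 2 \<in> hom C M Z \<and> f \<cdot> \<mu> 0 = \<mu> 2 \<and> g \<cdot> \<mu> 1 = \<mu> 2" for M \<mu>
    by (auto simp: is_cone_def J_def F_def idn_cmp)
  have L': "L \<in> obj C" "\<pi> 0 \<in> hom C L X" "\<pi> 1 \<in> hom C L Y" "f \<cdot> \<pi> 0 = \<pi> 2" "g \<cdot> \<pi> 1 = \<pi> 2"
    using L cone by (auto simp: is_limit_def)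
  have "is_pullback C f g L (\<pi> 0) (\<pi> 1)"
    unfolding is_pullback_def
  proof (intro conjI ballI impI)
    fix A a b assume A: "A \<in> obj C" and a: "a \<in> hom C A (src C f)" and b: "b \<in> hom C A (src C g)"
      and eq: "f \<cdot> a = g \<cdot> b"
    define \<mu> where "\<mu> i = (if i = (0::nat) then a else if i = 1 then b else f \<cdot> a)" for i
    have "is_cone J C F A \<mu>"
      using A a b eq f g by (auto simp: cone \<mu>_def hom_def cat_simps)
    then have ex: "\<exists>!h. h \<in> hom C A L \<and> (\<forall>j\<in>obj J. \<pi> j \<cdot> h = \<mu> j)"
      using L by (simp add: is_limit_def)
    have "(\<forall>j\<in>obj J. \<pi> j \<cdot> h = \<mu> j) \<longleftrightarrow> \<pi> 0 \<cdot> h = a \<and> \<pi> 1 \<cdot> h = b" if h: "h \<in> hom C A L" for h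
    proof -
      have "\<pi> 2 \<cdot> h = f \<cdot> (\<pi> 0 \<cdot> h)"
        using h L'(2) f by (auto simp: L'(4)[symmetric] hom_def cat_simps)
      then show ?thesis
        by (auto simp: J_def \<mu>_def)
    qed
    then show "\<exists>!h. h \<in> hom C A L \<and> \<pi> 0 \<cdot> h = a \<and> \<pi> 1 \<cdot> h = b"
      using ex by (simp cong: conj_cong)
  qed (use L' f g in \<open>auto simp: hom_def\<close>)
  then show ?thesis
    by blast
qed

lemma square_is_product:
  assumes "X \<in> obj C" shows "is_product C X X (sq C X) (pr0 C X) (pr1 C X)"
proof -
  have "\<exists>t. (\<lambda>(P, p, q). is_product C X X P p q) t"
    using product_exists[OF assms assms] by auto
  then have "(\<lambda>(P, p, q). is_product C X X P p q) (square C X)"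
    unfolding square_def by (rule someI_ex)
  then show ?thesis
    by (simp add: sq_def pr0_def pr1_def split_beta)
qed

lemma pr_hom:
  assumes "X \<in> obj C"
  shows "pr0 C X \<in> hom C (sq C X) X" "pr1 C X \<in> hom C (sq C X) X"
  using square_is_product[OF assms] by (auto simp: is_product_def)

lemma pr_arr:
  assumes "X \<in> obj C"
  shows "pr0 C X \<in> arr C" "src C (pr0 C X) = sq C X" "tgt C (pr0 C X) = X"
    "pr1 C X \<in> arr C" "src C (pr1 C X) = sq C X" "tgt C (pr1 C X) = X"
  using pr_hom[OF assms] by (auto simp: hom_def)

lemma pairing:
  assumes a: "a \<in> hom C A X" and b: "b \<in> hom C A X"
  shows "pairing C X a b \<in> hom C A (sq C X)"
    "pr0 C X \<cdot> pairing C X a b = a" "pr1 C X \<cdot> pairing C X a b = b"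
proof -
  have "\<exists>!h. h \<in> hom C A (sq C X) \<and> pr0 C X \<cdot> h = a \<and> pr1 C X \<cdot> h = b"
    using square_is_product[OF homD(5)[OF a]] homD(4)[OF a] a b by (simp add: is_product_def)
  from theI'[OF this] show "pairing C X a b \<in> hom C A (sq C X)"
    "pr0 C X \<cdot> pairing C X a b = a" "pr1 C X \<cdot> pairing C X a b = b"
    using homD(2)[OF a] by (auto simp: pairing_def)
qed

lemma sq_ext:
  assumes "X \<in> obj C" "h \<in> hom C A (sq C X)" "k \<in> hom C A (sq C X)"
    and "pr0 C X \<cdot> h = pr0 C X \<cdot> k" "pr1 C X \<cdot> h = pr1 C X \<cdot> k"
  shows "h = k"
proof -
  have "pr0 C X \<cdot> h \<in> hom C A X" "pr1 C X \<cdot> h \<in> hom C A X" "A \<in> obj C"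
    using assms(2) pr_hom[OF assms(1)] cmp_hom homD(4) by blast+
  then have "\<exists>!l. l \<in> hom C A (sq C X) \<and> pr0 C X \<cdot> l = pr0 C X \<cdot> h \<and> pr1 C X \<cdot> l = pr1 C X \<cdot> h"
    using square_is_product[OF assms(1)] unfolding is_product_def by blast
  then show ?thesis
    using assms by metis
qed

lemma sq_map:
  assumes f: "f \<in> hom C X Y"
  shows "sq_map C f \<in> hom C (sq C X) (sq C Y)"
    and "k \<in> hom C A (sq C X) \<Longrightarrow> pr0 C Y \<cdot> sq_map C f \<cdot> k = f \<cdot> pr0 C X \<cdot> k"
    and "k \<in> hom C A (sq C X) \<Longrightarrow> pr1 C Y \<cdot> sq_map C f \<cdot> k = f \<cdot> pr1 C X \<cdot> k"
proof -
  note X = homD(4)[OF f] and Y = homD(5)[OF f]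
  have h: "f \<cdot> pr0 C X \<in> hom C (sq C X) Y" "f \<cdot> pr1 C X \<in> hom C (sq C X) Y"
    using f pr_hom[OF X] cmp_hom by blast+
  have eq: "sq_map C f = pairing C Y (f \<cdot> pr0 C X) (f \<cdot> pr1 C X)"
    using f by (simp add: sq_map_def hom_def)
  note p = pairing[OF h, folded eq]
  show "sq_map C f \<in> hom C (sq C X) (sq C Y)"
    by (rule p)
  assume k: "k \<in> hom C A (sq C X)"
  have "pr0 C Y \<cdot> sq_map C f \<cdot> k = (pr0 C Y \<cdot> sq_map C f) \<cdot> k"
    using k p(1) by (simp add: hom_def cat_simps pr_arr Y)
  then show "pr0 C Y \<cdot> sq_map C f \<cdot> k = f \<cdot> pr0 C X \<cdot> k"
    using k f by (simp add: p(2) hom_def cat_simps pr_arr X)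
  have "pr1 C Y \<cdot> sq_map C f \<cdot> k = (pr1 C Y \<cdot> sq_map C f) \<cdot> k"
    using k p(1) by (simp add: hom_def cat_simps pr_arr Y)
  then show "pr1 C Y \<cdot> sq_map C f \<cdot> k = f \<cdot> pr1 C X \<cdot> k"
    using k f by (simp add: p(3) hom_def cat_simps pr_arr X)
qed

end


section \<open>Relations through their generalised elements\<close>

context finitely_complete
begin

lemma relations_rep:
  assumes "R \<in> relations C X" "r \<in> R"
  shows "is_mono C r" "r \<in> hom C (src C r) (sq C X)"
    "n \<in> R \<Longrightarrow> \<exists>u\<in>hom C (src C n) (src C r). r \<cdot> u = n"
proof -
  obtain m where m: "is_mono C m" "tgt C m = sq C X" "R = subobject_class C m"
    using assms(1) by (auto simp: relations_def subobjects_def)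
  note iff = mem_subobject_class_iff[OF m(1)]
  show r: "is_mono C r" "r \<in> hom C (src C r) (sq C X)"
    using assms(2) m mono_hom[of r] by (auto simp: iff)
  assume "n \<in> R"
  then obtain u v where u: "u \<in> hom C (src C n) (src C m)" "m \<cdot> u = n"
    and v: "v \<in> hom C (src C m) (src C r)" "r \<cdot> v = m"
    using assms(2) m(3) by (auto simp: iff)
  then have "v \<cdot> u \<in> hom C (src C n) (src C r)" "r \<cdot> (v \<cdot> u) = n"
    using cmp_hom[OF u(1) v(1)] cmp_eqD[OF v(2,1) r(2) u(1)] by auto
  then show "\<exists>u\<in>hom C (src C n) (src C r). r \<cdot> u = n"
    by blast
qed

lemma relations_nonempty: "R \<in> relations C X \<Longrightarrow> \<exists>r. r \<in> R"
  using mono_mem_subobject_class by (auto simp: relations_def subobjects_def)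

lemma subobject_class_relation:
  "is_mono C m \<Longrightarrow> tgt C m = sq C X \<Longrightarrow> subobject_class C m \<in> relations C X"
  by (auto simp: relations_def subobjects_def)

lemma mem_hom_relation_iff:
  assumes X: "X \<in> obj C" and R: "R \<in> relations C X" and r: "r \<in> R"
  shows "(a, b) \<in> hom_relation C X R A \<longleftrightarrow>
    (\<exists>h\<in>hom C A (src C r). pr0 C X \<cdot> r \<cdot> h = a \<and> pr1 C X \<cdot> r \<cdot> h = b)"
proof
  assume "(a, b) \<in> hom_relation C X R A"
  then obtain n k where n: "n \<in> R" "k \<in> hom C A (src C n)"
    and ab: "a = pr0 C X \<cdot> n \<cdot> k" "b = pr1 C X \<cdot> n \<cdot> k"
    by (auto simp: hom_relation_def)
  obtain u where u: "u \<in> hom C (src C n) (src C r)" "r \<cdot> u = n"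
    using relations_rep(3)[OF R r n(1)] by blast
  have "r \<cdot> (u \<cdot> k) = n \<cdot> k"
    by (rule cmp_eqD[OF u(2,1) relations_rep(2)[OF R r] n(2)])
  moreover have "u \<cdot> k \<in> hom C A (src C r)"
    using u n(2) cmp_hom by blast
  ultimately show "\<exists>h\<in>hom C A (src C r). pr0 C X \<cdot> r \<cdot> h = a \<and> pr1 C X \<cdot> r \<cdot> h = b"
    unfolding ab by (metis (no_types))
qed (use r in \<open>auto simp: hom_relation_def\<close>)

lemma hom_relation_hom:
  assumes X: "X \<in> obj C" and R: "R \<in> relations C X" and ab: "(a, b) \<in> hom_relation C X R A"
  shows "a \<in> hom C A X" "b \<in> hom C A X"
proof -
  obtain r where r: "r \<in> R"
    using relations_nonempty[OF R] by blast
  obtain h where "h \<in> hom C A (src C r)" "a = pr0 C X \<cdot> r \<cdot> h" "b = pr1 C X \<cdot> r \<cdot> h"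
    using ab unfolding mem_hom_relation_iff[OF X R r] by blast
  then show "a \<in> hom C A X" "b \<in> hom C A X"
    using relations_rep(2)[OF R r] pr_hom[OF X] cmp_hom by blast+
qed

text \<open>Generalised elements can be restricted along any change of stage.\<close>

lemma hom_relation_restrict:
  assumes X: "X \<in> obj C" and R: "R \<in> relations C X" and ab: "(a, b) \<in> hom_relation C X R A"
    and e: "e \<in> hom C B A"
  shows "(a \<cdot> e, b \<cdot> e) \<in> hom_relation C X R B"
proof -
  obtain r where r: "r \<in> R"
    using relations_nonempty[OF R] by blast
  obtain h where h: "h \<in> hom C A (src C r)" "a = pr0 C X \<cdot> r \<cdot> h" "b = pr1 C X \<cdot> r \<cdot> h"
    using ab unfolding mem_hom_relation_iff[OF X R r] by blast
  have "h \<cdot> e \<in> hom C B (src C r)" "pr0 C X \<cdot> r \<cdot> (h \<cdot> e) = a \<cdot> e" "pr1 C X \<cdot> r \<cdot> (h \<cdot> e) = b \<cdot> e"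
    using h e relations_rep(2)[OF R r] by (auto simp: hom_def cat_simps pr_arr X)
  then show ?thesis
    unfolding mem_hom_relation_iff[OF X R r] by blast
qed

text \<open>As in the Yoneda lemma, a relation has a generic element, whose stage is the relation itself:
  every other element is a restriction of it, so inclusions need to be tested on it alone.\<close>

lemma generic_element:
  assumes X: "X \<in> obj C" and R: "R \<in> relations C X" and r: "r \<in> R"
  shows "(pr0 C X \<cdot> r, pr1 C X \<cdot> r) \<in> hom_relation C X R (src C r)"
  unfolding mem_hom_relation_iff[OF assms]
  using relations_rep(2)[OF R r] by (intro bexI[of _ "idn C (src C r)"]) (auto simp: hom_def cat_simps)

lemma subobject_le_if_generic:
  assumes X: "X \<in> obj C" and S: "S \<in> relations C X" and r: "r \<in> R" "r \<in> hom C (src C r) (sq C X)"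
    and "(pr0 C X \<cdot> r, pr1 C X \<cdot> r) \<in> hom_relation C X S (src C r)"
  shows "subobject_le C R S"
proof -
  obtain s where s: "s \<in> S"
    using relations_nonempty[OF S] by blast
  obtain h where h: "h \<in> hom C (src C r) (src C s)"
    "pr0 C X \<cdot> s \<cdot> h = pr0 C X \<cdot> r" "pr1 C X \<cdot> s \<cdot> h = pr1 C X \<cdot> r"
    using assms(5) unfolding mem_hom_relation_iff[OF X S s] by blast
  have "s \<cdot> h = r"
    by (rule sq_ext[OF X cmp_hom[OF h(1) relations_rep(2)[OF S s]] r(2) h(2,3)])
  then show ?thesis
    using r(1) s h(1) unfolding subobject_le_def by blast
qed

lemma subobject_le_iff:
  assumes X: "X \<in> obj C" and R: "R \<in> relations C X" and S: "S \<in> relations C X"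
  shows "subobject_le C R S \<longleftrightarrow>
    (\<forall>A a b. (a, b) \<in> hom_relation C X R A \<longrightarrow> (a, b) \<in> hom_relation C X S A)"
proof (intro iffI allI impI)
  fix A a b
  assume "subobject_le C R S" and ab: "(a, b) \<in> hom_relation C X R A"
  then obtain r s h where r: "r \<in> R" "s \<in> S" and h: "h \<in> hom C (src C r) (src C s)" "s \<cdot> h = r"
    by (auto simp: subobject_le_def)
  obtain k where k: "k \<in> hom C A (src C r)" "a = pr0 C X \<cdot> r \<cdot> k" "b = pr1 C X \<cdot> r \<cdot> k"
    using ab unfolding mem_hom_relation_iff[OF X R r(1)] by blast
  have "s \<cdot> (h \<cdot> k) = r \<cdot> k"
    by (rule cmp_eqD[OF h(2,1) relations_rep(2)[OF S r(2)] k(1)])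
  then show "(a, b) \<in> hom_relation C X S A"
    unfolding mem_hom_relation_iff[OF X S r(2)] k(2,3) using cmp_hom[OF k(1) h(1)]
    by (metis (no_types))
next
  assume *: "\<forall>A a b. (a, b) \<in> hom_relation C X R A \<longrightarrow> (a, b) \<in> hom_relation C X S A"
  obtain r where r: "r \<in> R"
    using relations_nonempty[OF R] by blast
  show "subobject_le C R S"
    using r relations_rep(2)[OF R r] * generic_element[OF X R r]
    by (intro subobject_le_if_generic[OF X S]) auto
qed

lemma subobject_le_antisym:
  assumes R: "R \<in> relations C X" and S: "S \<in> relations C X"
    and "subobject_le C R S" "subobject_le C S R"
  shows "R = S"
proof -
  have sub: "S' \<subseteq> R'" if R': "R' \<in> relations C X" and S': "S' \<in> relations C X"
    and RS: "subobject_le C R' S'" and SR: "subobject_le C S' R'" for R' S'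
  proof
    fix n assume n: "n \<in> S'"
    obtain m where m: "is_mono C m" "tgt C m = sq C X" "R' = subobject_class C m"
      using R' by (auto simp: relations_def subobjects_def)
    have mR: "m \<in> R'"
      using m mono_mem_subobject_class by simp
    have fac: "\<exists>h\<in>hom C (src C t) (src C t'). t' \<cdot> h = t"
      if that': "U \<in> relations C X" "V \<in> relations C X" "subobject_le C U V" "t \<in> U" "t' \<in> V" for U V t t'
    proof -
      obtain r s h where r: "r \<in> U" "s \<in> V" and h: "h \<in> hom C (src C r) (src C s)" "s \<cdot> h = r"
        using that'(3) by (auto simp: subobject_le_def)
      obtain u where u: "u \<in> hom C (src C t) (src C r)" "r \<cdot> u = t"
        using relations_rep(3)[OF that'(1) r(1) that'(4)] by blast
      obtain v where v: "v \<in> hom C (src C s) (src C t')" "t' \<cdot> v = s"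
        using relations_rep(3)[OF that'(2,5) r(2)] by blast
      have "t' \<cdot> (v \<cdot> (h \<cdot> u)) = t"
        using cmp_eqD[OF v(2,1) relations_rep(2)[OF that'(2,5)] cmp_hom[OF u(1) h(1)]]
          cmp_eqD[OF h(2,1) relations_rep(2)[OF that'(2) r(2)] u(1)] u(2) by simp
      then show ?thesis
        using u(1) h(1) v(1) cmp_hom by blast
    qed
    show "n \<in> R'"
      unfolding m(3) mem_subobject_class_iff[OF m(1)]
      using relations_rep(1)[OF S' n] homD(3)[OF relations_rep(2)[OF S' n]] m(2) fac[OF S' R' SR n mR] fac[OF R' S' RS mR n]
      by simp
  qed
  show ?thesis
    using sub[OF R S] sub[OF S R] assms by blast
qed

lemma diagonal:
  assumes X: "X \<in> obj C"
  shows "diagonal C X \<in> relations C X"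
    and "(a, b) \<in> hom_relation C X (diagonal C X) A \<longleftrightarrow> a \<in> hom C A X \<and> a = b"
proof -
  define d where "d = pairing C X (idn C X) (idn C X)"
  note p = pairing[OF idn_hom[OF X] idn_hom[OF X], folded d_def]
  have pr: "pr0 C X \<cdot> d \<cdot> h = h" "pr1 C X \<cdot> d \<cdot> h = h" if h: "h \<in> hom C B X" for B h
  proof -
    have "pr0 C X \<cdot> d \<cdot> h = (pr0 C X \<cdot> d) \<cdot> h" "pr1 C X \<cdot> d \<cdot> h = (pr1 C X \<cdot> d) \<cdot> h"
      using p(1) h by (auto simp: hom_def cat_simps pr_arr X)
    then show "pr0 C X \<cdot> d \<cdot> h = h" "pr1 C X \<cdot> d \<cdot> h = h"
      using p h by (auto simp: hom_def cat_simps)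
  qed
  have mono: "is_mono C d"
    using p(1) by (rule is_monoI) (metis pr(1))
  show rel: "diagonal C X \<in> relations C X"
    unfolding diagonal_def d_def[symmetric]
    using mono p(1) by (intro subobject_class_relation) (auto simp: hom_def)
  have d: "d \<in> diagonal C X"
    unfolding diagonal_def d_def[symmetric] by (rule mono_mem_subobject_class[OF mono])
  show "(a, b) \<in> hom_relation C X (diagonal C X) A \<longleftrightarrow> a \<in> hom C A X \<and> a = b"
    unfolding mem_hom_relation_iff[OF X rel d] homD(2)[OF p(1)] using pr by auto
qed

text \<open>Two pullbacks of representatives of \<open>S\<close> factor through each other; conversely, a monomorphism
  \<open>k\<close> that is equivalent to the leg \<open>r\<close> of a pullback is itself a leg of one. Hence the inverse
  image is a full class of monomorphisms, that is, a relation.\<close>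

lemma inverse_image_eq_class:
  assumes f: "f \<in> hom C X Y" and S: "S \<in> relations C Y" and s: "s \<in> S"
    and pb: "is_pullback C (sq_map C f) s P r q"
  shows "is_mono C r" "inverse_image C f S = subobject_class C r"
proof -
  note F = sq_map(1)[OF f]
  have pbD: "r' \<in> hom C P' (sq C X)" "q' \<in> hom C P' (src C t)" "sq_map C f \<cdot> r' = t \<cdot> q'"
    "a \<in> hom C A (sq C X) \<Longrightarrow> b \<in> hom C A (src C t) \<Longrightarrow> sq_map C f \<cdot> a = t \<cdot> b \<Longrightarrow>
      \<exists>!h. h \<in> hom C A P' \<and> r' \<cdot> h = a \<and> q' \<cdot> h = b"
    if "is_pullback C (sq_map C f) t P' r' q'" for t P' r' q' a b A
    using that homD(2)[OF F] homD(4) unfolding is_pullback_def by auto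
  have mono: "is_mono C r'" if t: "t \<in> S" and pb': "is_pullback C (sq_map C f) t P' r' q'"
    for t P' r' q'
    using pbD(1)[OF pb']
  proof (rule is_monoI)
    fix A u v assume uv: "u \<in> hom C A P'" "v \<in> hom C A P'" "r' \<cdot> u = r' \<cdot> v"
    note th = relations_rep[OF S t]
    note D = pbD[OF pb']
    have "t \<cdot> (q' \<cdot> w) = sq_map C f \<cdot> (r' \<cdot> w)" if w: "w \<in> hom C A P'" for w
    proof -
      have "t \<cdot> (q' \<cdot> w) = (sq_map C f \<cdot> r') \<cdot> w"
        unfolding D(3) using th(2) D(2) w by (auto simp: hom_def cat_simps)
      then show ?thesis
        using F D(1) w by (auto simp: hom_def cat_simps)
    qed
    note e = this
    have "q' \<cdot> u = q' \<cdot> v"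
      using e[OF uv(1)] e[OF uv(2)] uv(3)
      by (intro is_monoD[OF th(1) cmp_hom[OF uv(1) D(2)] cmp_hom[OF uv(2) D(2)]]) simp
    moreover have "\<exists>!h. h \<in> hom C A P' \<and> r' \<cdot> h = r' \<cdot> v \<and> q' \<cdot> h = q' \<cdot> v"
      by (rule D(4)[OF cmp_hom[OF uv(2) D(1)] cmp_hom[OF uv(2) D(2)] e[OF uv(2), symmetric]])
    ultimately show "u = v"
      using uv by metis
  qed
  show r: "is_mono C r"
    by (rule mono[OF s pb])
  note D = pbD[OF pb]
  have fac: "\<exists>h\<in>hom C P' P''. r'' \<cdot> h = r'"
    if t: "t \<in> S" "t' \<in> S" and pb': "is_pullback C (sq_map C f) t P' r' q'"
    and pb'': "is_pullback C (sq_map C f) t' P'' r'' q''" for t t' P' r' q' P'' r'' q''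
  proof -
    obtain u where u: "u \<in> hom C (src C t) (src C t')" "t' \<cdot> u = t"
      using relations_rep(3)[OF S t(2,1)] by blast
    have "sq_map C f \<cdot> r' = t' \<cdot> (u \<cdot> q')"
      using cmp_eqD[OF u(2,1) relations_rep(2)[OF S t(2)] pbD(2)[OF pb']] pbD(3)[OF pb'] by simp
    then show ?thesis
      using pbD(4)[OF pb'' pbD(1)[OF pb'] cmp_hom[OF pbD(2)[OF pb'] u(1)]] by blast
  qed
  show "inverse_image C f S = subobject_class C r"
  proof (intro Set.set_eqI iffI)
    fix k assume "k \<in> inverse_image C f S"
    then obtain t P' q' where t: "t \<in> S" and pb': "is_pullback C (sq_map C f) t P' k q'"
      by (auto simp: inverse_image_def)
    show "k \<in> subobject_class C r"
      unfolding mem_subobject_class_iff[OF r]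
      using mono[OF t pb'] fac[OF t s pb' pb] fac[OF s t pb pb'] D(1) pbD(1)[OF pb']
      by (auto simp: hom_def)
  next
    fix k assume "k \<in> subobject_class C r"
    then obtain u v where k: "is_mono C k" "tgt C k = sq C X"
      and u: "u \<in> hom C (src C k) P" "r \<cdot> u = k" and v: "v \<in> hom C P (src C k)" "k \<cdot> v = r"
      unfolding mem_subobject_class_iff[OF r] using D(1) by (auto simp: hom_def)
    have kh: "k \<in> hom C (src C k) (sq C X)"
      using k mono_hom by metis
    have sh: "s \<in> hom C (src C s) (sq C Y)"
      by (rule relations_rep(2)[OF S s])
    have "r \<cdot> (u \<cdot> v) = r \<cdot> idn C P"
      using cmp_eqD[OF u(2,1) D(1) v(1)] v(2) cmp_idn[OF D(1)] by simp
    then have uv: "u \<cdot> v = idn C P"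
      using is_monoD[OF r, unfolded homD(2)[OF D(1)]] cmp_hom[OF v(1) u(1)]
        idn_hom[OF homD(4)[OF D(1)]] by blast
    have "is_pullback C (sq_map C f) s (src C k) k (q \<cdot> u)"
      unfolding is_pullback_def
    proof (intro conjI ballI impI)
      have "sq_map C f \<cdot> k = (sq_map C f \<cdot> r) \<cdot> u"
        using cmp_assoc[OF u(1) D(1) F] u(2) by simp
      then show "sq_map C f \<cdot> k = s \<cdot> q \<cdot> u"
        unfolding D(3) using sh D(2) u by (auto simp: hom_def cat_simps)
      fix A a b assume a: "a \<in> hom C A (src C (sq_map C f))" and b: "b \<in> hom C A (src C s)"
        and "sq_map C f \<cdot> a = s \<cdot> b"
      then obtain h where h: "h \<in> hom C A P" "r \<cdot> h = a" "q \<cdot> h = b"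
        using D(4)[of a A b] homD(2)[OF F] by auto
      have 1: "k \<cdot> (v \<cdot> h) = a"
        using cmp_eqD[OF v(2,1) kh h(1)] h(2) by simp
      have "(q \<cdot> u) \<cdot> (v \<cdot> h) = q \<cdot> ((u \<cdot> v) \<cdot> h)"
        using D(2) u v h by (auto simp: hom_def cat_simps)
      then have 2: "(q \<cdot> u) \<cdot> (v \<cdot> h) = b"
        unfolding uv using h by (auto simp: hom_def cat_simps)
      show "\<exists>!h. h \<in> hom C A (src C k) \<and> k \<cdot> h = a \<and> (q \<cdot> u) \<cdot> h = b"
        using 1 2 cmp_hom[OF h(1) v(1)] is_monoD[OF k(1)] by metis
    qed (use F kh sh D u cmp_hom homD(4) in \<open>auto simp: hom_def cat_simps\<close>)
    then show "k \<in> inverse_image C f S"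
      using s by (auto simp: inverse_image_def)
  qed
qed

lemma inverse_image:
  assumes f: "f \<in> hom C X Y" and S: "S \<in> relations C Y"
  shows "inverse_image C f S \<in> relations C X"
    and "(a, b) \<in> hom_relation C X (inverse_image C f S) A \<longleftrightarrow>
      a \<in> hom C A X \<and> b \<in> hom C A X \<and> (f \<cdot> a, f \<cdot> b) \<in> hom_relation C Y S A"
proof -
  note X = homD(4)[OF f] and Y = homD(5)[OF f] and F = sq_map(1)[OF f]
  obtain s where s: "s \<in> S"
    using relations_nonempty[OF S] by blast
  note sh = relations_rep(2)[OF S s]
  obtain P r q where pb: "is_pullback C (sq_map C f) s P r q"
    using pullback_exists[OF F sh] by blast
  have r: "r \<in> hom C P (sq C X)" and q: "q \<in> hom C P (src C s)" and eq: "sq_map C f \<cdot> r = s \<cdot> q"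
    using pb homD(2)[OF F] by (auto simp: is_pullback_def)
  note cl = inverse_image_eq_class[OF f S s pb]
  show rel: "inverse_image C f S \<in> relations C X"
    unfolding cl(2) using cl(1) r by (intro subobject_class_relation) (auto simp: hom_def)
  have rI: "r \<in> inverse_image C f S"
    unfolding cl(2) by (rule mono_mem_subobject_class[OF cl(1)])
  show "(a, b) \<in> hom_relation C X (inverse_image C f S) A \<longleftrightarrow>
      a \<in> hom C A X \<and> b \<in> hom C A X \<and> (f \<cdot> a, f \<cdot> b) \<in> hom_relation C Y S A"
  proof (intro iffI conjI)
    assume ab: "(a, b) \<in> hom_relation C X (inverse_image C f S) A"
    show "a \<in> hom C A X" "b \<in> hom C A X"
      by (rule hom_relation_hom[OF X rel ab])+
    obtain h where h: "h \<in> hom C A P" "a = pr0 C X \<cdot> r \<cdot> h" "b = pr1 C X \<cdot> r \<cdot> h"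
      using ab unfolding mem_hom_relation_iff[OF X rel rI] homD(2)[OF r] by blast
    have "s \<cdot> (q \<cdot> h) = (sq_map C f \<cdot> r) \<cdot> h"
      unfolding eq using sh q h(1) by (auto simp: hom_def cat_simps)
    also have "\<dots> = sq_map C f \<cdot> (r \<cdot> h)"
      using F r h(1) by (auto simp: hom_def cat_simps)
    finally have "s \<cdot> (q \<cdot> h) = sq_map C f \<cdot> (r \<cdot> h)" .
    then have "pr0 C Y \<cdot> s \<cdot> (q \<cdot> h) = f \<cdot> a" "pr1 C Y \<cdot> s \<cdot> (q \<cdot> h) = f \<cdot> b"
      using sq_map(2,3)[OF f cmp_hom[OF h(1) r]] h(2,3) by simp_all
    then show "(f \<cdot> a, f \<cdot> b) \<in> hom_relation C Y S A"
      unfolding mem_hom_relation_iff[OF Y S s] using cmp_hom[OF h(1) q] by blast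
  next
    assume "a \<in> hom C A X \<and> b \<in> hom C A X \<and> (f \<cdot> a, f \<cdot> b) \<in> hom_relation C Y S A"
    then obtain k where ab: "a \<in> hom C A X" "b \<in> hom C A X" and k: "k \<in> hom C A (src C s)"
      "pr0 C Y \<cdot> s \<cdot> k = f \<cdot> a" "pr1 C Y \<cdot> s \<cdot> k = f \<cdot> b"
      unfolding mem_hom_relation_iff[OF Y S s] by blast
    note p = pairing[OF ab]
    have "sq_map C f \<cdot> pairing C X a b = s \<cdot> k"
      using sq_map(2,3)[OF f p(1)] p(2,3) k(2,3)
      by (intro sq_ext[OF Y cmp_hom[OF p(1) F] cmp_hom[OF k(1) sh]]) simp_all
    moreover have "\<forall>B\<in>obj C. \<forall>c\<in>hom C B (sq C X). \<forall>d\<in>hom C B (src C s).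
        sq_map C f \<cdot> c = s \<cdot> d \<longrightarrow> (\<exists>!h. h \<in> hom C B P \<and> r \<cdot> h = c \<and> q \<cdot> h = d)"
      using pb homD(2)[OF F] by (simp add: is_pullback_def)
    ultimately obtain h where h: "h \<in> hom C A P" "r \<cdot> h = pairing C X a b"
      using p(1) k(1) homD(4)[OF p(1)] by blast
    then show "(a, b) \<in> hom_relation C X (inverse_image C f S) A"
      unfolding mem_hom_relation_iff[OF X rel rI] homD(2)[OF r]
      by (intro bexI[OF _ h(1)]) (simp add: h(2) p)
  qed
qed

lemma reflexive_rels_iff:
  assumes X: "X \<in> obj C"
  shows "R \<in> reflexive_rels C X \<longleftrightarrow> R \<in> relations C X \<and>
    (\<forall>A. \<forall>a\<in>hom C A X. (a, a) \<in> hom_relation C X R A)"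
  by (auto simp: reflexive_rels_def subobject_le_iff[OF X diagonal(1)[OF X]] diagonal(2)[OF X])

lemma transitive_rels_iff:
  assumes X: "X \<in> obj C"
  shows "R \<in> transitive_rels C X \<longleftrightarrow> R \<in> relations C X \<and>
    (\<forall>A a b c. (a, b) \<in> hom_relation C X R A \<longrightarrow> (b, c) \<in> hom_relation C X R A \<longrightarrow>
      (a, c) \<in> hom_relation C X R A)"
  using hom_relation_hom[OF X] homD(4) unfolding transitive_rels_def trans_def by blast

lemma symmetric_rels_iff:
  assumes X: "X \<in> obj C"
  shows "R \<in> symmetric_rels C X \<longleftrightarrow> R \<in> relations C X \<and>
    (\<forall>A a b. (a, b) \<in> hom_relation C X R A \<longrightarrow> (b, a) \<in> hom_relation C X R A)"
proof (cases "R \<in> relations C X")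
  case R: True
  define \<sigma> where "\<sigma> = pairing C X (pr1 C X) (pr0 C X)"
  note p = pairing[OF pr_hom(2,1)[OF X], folded \<sigma>_def]
  have \<sigma>: "\<sigma> \<cdot> k \<in> hom C A (sq C X)" "pr0 C X \<cdot> \<sigma> \<cdot> k = pr1 C X \<cdot> k"
    "pr1 C X \<cdot> \<sigma> \<cdot> k = pr0 C X \<cdot> k" if k: "k \<in> hom C A (sq C X)" for k A
  proof -
    show "\<sigma> \<cdot> k \<in> hom C A (sq C X)"
      using k p(1) cmp_hom by blast
    have "pr0 C X \<cdot> \<sigma> \<cdot> k = (pr0 C X \<cdot> \<sigma>) \<cdot> k" "pr1 C X \<cdot> \<sigma> \<cdot> k = (pr1 C X \<cdot> \<sigma>) \<cdot> k"
      using k p(1) by (auto simp: hom_def cat_simps pr_arr X)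
    then show "pr0 C X \<cdot> \<sigma> \<cdot> k = pr1 C X \<cdot> k" "pr1 C X \<cdot> \<sigma> \<cdot> k = pr0 C X \<cdot> k"
      by (simp_all add: p)
  qed
  have "subobject_le C (opposite C X R) R \<longleftrightarrow>
    (\<forall>A a b. (a, b) \<in> hom_relation C X R A \<longrightarrow> (b, a) \<in> hom_relation C X R A)"
  proof (intro iffI allI impI)
    fix A a b assume "subobject_le C (opposite C X R) R" and ab: "(a, b) \<in> hom_relation C X R A"
    then obtain r s h where r: "r \<in> R" "s \<in> R"
      and h: "h \<in> hom C (src C (\<sigma> \<cdot> r)) (src C s)" "s \<cdot> h = \<sigma> \<cdot> r"
      by (auto simp: subobject_le_def opposite_def \<sigma>_def)
    note rh = relations_rep(2)[OF R r(1)] and sh = relations_rep(2)[OF R r(2)]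
    have h': "h \<in> hom C (src C r) (src C s)"
      using h(1) homD(2)[OF \<sigma>(1)[OF rh]] by simp
    obtain k where k: "k \<in> hom C A (src C r)" "a = pr0 C X \<cdot> r \<cdot> k" "b = pr1 C X \<cdot> r \<cdot> k"
      using ab unfolding mem_hom_relation_iff[OF X R r(1)] by blast
    have "s \<cdot> (h \<cdot> k) = (\<sigma> \<cdot> r) \<cdot> k"
      by (rule cmp_eqD[OF h(2) h' sh k(1)])
    also have "\<dots> = \<sigma> \<cdot> (r \<cdot> k)"
      using p(1) k(1) rh by (auto simp: hom_def cat_simps)
    finally have "s \<cdot> (h \<cdot> k) = \<sigma> \<cdot> (r \<cdot> k)" .
    then have "pr0 C X \<cdot> s \<cdot> (h \<cdot> k) = b" "pr1 C X \<cdot> s \<cdot> (h \<cdot> k) = a"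
      using \<sigma>(2,3)[OF cmp_hom[OF k(1) rh]] k(2,3) by simp_all
    then show "(b, a) \<in> hom_relation C X R A"
      unfolding mem_hom_relation_iff[OF X R r(2)] using cmp_hom[OF k(1) h'] by blast
  next
    assume sym: "\<forall>A a b. (a, b) \<in> hom_relation C X R A \<longrightarrow> (b, a) \<in> hom_relation C X R A"
    obtain r where r: "r \<in> R"
      using relations_nonempty[OF R] by blast
    note rh = relations_rep(2)[OF R r]
    note \<sigma>r = \<sigma>[OF rh]
    have "\<sigma> \<cdot> r \<in> opposite C X R"
      using r by (simp add: opposite_def \<sigma>_def)
    then show "subobject_le C (opposite C X R) R"
      using \<sigma>r homD(2)[OF \<sigma>r(1)] sym generic_element[OF X R r]
      by (intro subobject_le_if_generic[OF X R, of "\<sigma> \<cdot> r"]) auto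
  qed
  then show ?thesis
    by (simp add: symmetric_rels_def R)
qed (simp add: symmetric_rels_def)

end


section \<open>Preorders and equivalence relations under inverse image\<close>

context finitely_complete
begin

lemma preorder_relsD:
  assumes X: "X \<in> obj C" and R: "R \<in> preorder_rels C X"
  shows "R \<in> relations C X"
    and "a \<in> hom C A X \<Longrightarrow> (a, a) \<in> hom_relation C X R A"
    and "(a, b) \<in> hom_relation C X R A \<Longrightarrow> (b, c) \<in> hom_relation C X R A \<Longrightarrow>
      (a, c) \<in> hom_relation C X R A"
  using R unfolding preorder_rels_def Int_iff reflexive_rels_iff[OF X] transitive_rels_iff[OF X]
  by blast+

lemma preorder_relsI:
  assumes X: "X \<in> obj C" and "R \<in> relations C X"
    and "\<And>A a. a \<in> hom C A X \<Longrightarrow> (a, a) \<in> hom_relation C X R A"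
    and "\<And>A a b c. (a, b) \<in> hom_relation C X R A \<Longrightarrow> (b, c) \<in> hom_relation C X R A \<Longrightarrow>
      (a, c) \<in> hom_relation C X R A"
  shows "R \<in> preorder_rels C X"
  using assms(2-)
  unfolding preorder_rels_def Int_iff reflexive_rels_iff[OF X] transitive_rels_iff[OF X] by blast

lemma equivalence_rels_iff:
  assumes X: "X \<in> obj C"
  shows "R \<in> equivalence_rels C X \<longleftrightarrow> R \<in> preorder_rels C X \<and>
    (\<forall>A a b. (a, b) \<in> hom_relation C X R A \<longrightarrow> (b, a) \<in> hom_relation C X R A)"
  using preorder_relsD(1)[OF X, of R] by (auto simp: equivalence_rels_def symmetric_rels_iff[OF X])

lemma inverse_image_preorder:
  assumes f: "f \<in> hom C X Y" and S: "S \<in> preorder_rels C Y"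
  shows "inverse_image C f S \<in> preorder_rels C X"
proof -
  note D = preorder_relsD[OF homD(5)[OF f] S]
  note I = inverse_image[OF f D(1)]
  show ?thesis
    using f cmp_hom D(2,3) by (intro preorder_relsI[OF homD(4)[OF f] I(1)]) (auto simp: I(2))
qed

lemma inverse_image_equivalence:
  assumes f: "f \<in> hom C X Y" and S: "S \<in> equivalence_rels C Y"
  shows "inverse_image C f S \<in> equivalence_rels C X"
proof -
  note Y = homD(5)[OF f] and X = homD(4)[OF f]
  have S': "S \<in> preorder_rels C Y"
    using S by (simp add: equivalence_rels_iff[OF Y])
  then show ?thesis
    using inverse_image_preorder[OF f S'] S unfolding equivalence_rels_iff[OF X] equivalence_rels_iff[OF Y]
    by (simp add: inverse_image(2)[OF f preorder_relsD(1)[OF Y]])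
qed

lemma inverse_image_mono:
  assumes f: "f \<in> hom C X Y" and R: "R \<in> relations C Y" and S: "S \<in> relations C Y"
    and le: "subobject_le C R S"
  shows "subobject_le C (inverse_image C f R) (inverse_image C f S)"
  using le unfolding subobject_le_iff[OF homD(5)[OF f] R S]
    subobject_le_iff[OF homD(4)[OF f] inverse_image(1)[OF f R] inverse_image(1)[OF f S]]
  by (simp add: inverse_image(2)[OF f R] inverse_image(2)[OF f S])

lemma subobject_le_refl: "X \<in> obj C \<Longrightarrow> R \<in> relations C X \<Longrightarrow> subobject_le C R R"
  by (simp add: subobject_le_iff)

lemma subobject_le_trans:
  assumes "X \<in> obj C" "R \<in> relations C X" "S \<in> relations C X" "T \<in> relations C X"
    and "subobject_le C R S" "subobject_le C S T"
  shows "subobject_le C R T"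
  using assms by (simp add: subobject_le_iff)

lemma inverse_image_idn:
  assumes X: "X \<in> obj C" and R: "R \<in> relations C X"
  shows "inverse_image C (idn C X) R = R"
proof (rule subobject_le_antisym)
  note I = inverse_image[OF idn_hom[OF X] R]
  have "(a, b) \<in> hom_relation C X (inverse_image C (idn C X) R) A \<longleftrightarrow> (a, b) \<in> hom_relation C X R A"
    for A a b
    unfolding I(2) using hom_relation_hom[OF X R] by (metis idn_cmp)
  then show "subobject_le C (inverse_image C (idn C X) R) R"
    "subobject_le C R (inverse_image C (idn C X) R)"
    unfolding subobject_le_iff[OF X I(1) R] subobject_le_iff[OF X R I(1)] by blast+
qed (use inverse_image(1)[OF idn_hom[OF X] R] R in auto)

definition kernel :: "'b \<Rightarrow> 'b set" where
  "kernel f = inverse_image C f (diagonal C (tgt C f))"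

lemma hom_relation_kernel:
  assumes f: "f \<in> hom C X Y"
  shows "(a, b) \<in> hom_relation C X (kernel f) A \<longleftrightarrow>
    a \<in> hom C A X \<and> b \<in> hom C A X \<and> f \<cdot> a = f \<cdot> b"
  unfolding kernel_def homD(3)[OF f] inverse_image(2)[OF f diagonal(1)[OF homD(5)[OF f]]]
    diagonal(2)[OF homD(5)[OF f]]
  using f cmp_hom by blast

lemma diagonal_equivalence:
  assumes X: "X \<in> obj C" shows "diagonal C X \<in> equivalence_rels C X"
  using diagonal[OF X] unfolding equivalence_rels_iff[OF X]
  by (auto intro!: preorder_relsI[OF X])

lemma kernel_equivalence:
  assumes f: "f \<in> hom C X Y" shows "kernel f \<in> equivalence_rels C X"
  unfolding kernel_def homD(3)[OF f]
  by (rule inverse_image_equivalence[OF f diagonal_equivalence[OF homD(5)[OF f]]])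

end


section \<open>Descent along regular epimorphisms\<close>

text \<open>Regular epimorphisms are orthogonal to monomorphisms: if \<open>e\<close> coequalizes \<open>p\<close> and \<open>q\<close>, then
  \<open>m\<close> being monic forces \<open>u \<cdot> p = u \<cdot> q\<close>, and the factor of \<open>u\<close> through \<open>e\<close> is the diagonal.\<close>

lemma (in finitely_complete) regular_epi_mono_lift:
  assumes e: "regular_epi C e" "e \<in> hom C B A" and m: "is_mono C m" "m \<in> hom C S P"
    and u: "u \<in> hom C B S" and v: "v \<in> hom C A P" and eq: "v \<cdot> e = m \<cdot> u"
  shows "\<exists>w\<in>hom C A S. m \<cdot> w = v"
proof -
  obtain p q where "is_coequalizer C p q e"
    using e(1) by (auto simp: regular_epi_def)
  then obtain D where pq: "p \<in> hom C D B" "q \<in> hom C D B" "e \<cdot> p = e \<cdot> q"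
    and univ: "\<And>W g. g \<in> hom C B W \<Longrightarrow> g \<cdot> p = g \<cdot> q \<Longrightarrow> \<exists>!h. h \<in> hom C A W \<and> h \<cdot> e = g"
    unfolding is_coequalizer_def homD(2,3)[OF e(2)] using homD(5) by blast
  have ve: "(v \<cdot> e) \<cdot> p = (v \<cdot> e) \<cdot> q"
    using pq cmp_assoc[OF pq(1) e(2) v] cmp_assoc[OF pq(2) e(2) v] by simp
  then have "m \<cdot> (u \<cdot> p) = m \<cdot> (u \<cdot> q)"
    unfolding eq using cmp_assoc[OF pq(1) u m(2)] cmp_assoc[OF pq(2) u m(2)] by simp
  then have "u \<cdot> p = u \<cdot> q"
    using is_monoD[OF m(1)] cmp_hom[OF pq(1) u] cmp_hom[OF pq(2) u] homD(2)[OF m(2)] by blast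
  then obtain w where w: "w \<in> hom C A S" "w \<cdot> e = u"
    using univ[OF u] by blast
  have "(m \<cdot> w) \<cdot> e = v \<cdot> e"
    using cmp_assoc[OF e(2) w(1) m(2)] w(2) eq by simp
  then have "m \<cdot> w = v"
    using univ[OF cmp_hom[OF e(2) v] ve] cmp_hom[OF w(1) m(2)] v by blast
  then show ?thesis
    using w(1) by blast
qed

text \<open>Converse of \<open>hom_relation_restrict\<close> along regular epimorphisms.\<close>

lemma (in finitely_complete) hom_relation_descend:
  assumes X: "X \<in> obj C" and R: "R \<in> relations C X" and e: "regular_epi C e" "e \<in> hom C B A"
    and ab: "a \<in> hom C A X" "b \<in> hom C A X" and R': "(a \<cdot> e, b \<cdot> e) \<in> hom_relation C X R B"
  shows "(a, b) \<in> hom_relation C X R A"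
proof -
  obtain r where r: "r \<in> R"
    using relations_nonempty[OF R] by blast
  note rr = relations_rep(1,2)[OF R r]
  obtain u where u: "u \<in> hom C B (src C r)" "pr0 C X \<cdot> r \<cdot> u = a \<cdot> e" "pr1 C X \<cdot> r \<cdot> u = b \<cdot> e"
    using R' unfolding mem_hom_relation_iff[OF X R r] by blast
  note p = pairing[OF ab]
  have "pairing C X a b \<cdot> e = r \<cdot> u"
    using cmp_eqD[OF p(2,1) pr_hom(1)[OF X] e(2)] cmp_eqD[OF p(3,1) pr_hom(2)[OF X] e(2)] u(2,3)
    by (intro sq_ext[OF X cmp_hom[OF e(2) p(1)] cmp_hom[OF u(1) rr(2)]]) simp_all
  then obtain w where "w \<in> hom C A (src C r)" "r \<cdot> w = pairing C X a b"
    using regular_epi_mono_lift[OF e rr u(1) p(1)] by blast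
  then show ?thesis
    unfolding mem_hom_relation_iff[OF X R r] using p(2,3) by (metis (no_types))
qed

context regular_category
begin

text \<open>Regular epimorphisms behave like surjections, up to a change of stage: the lift lives on the
  pullback of \<open>f\<close> along the element, which is again covered by a regular epimorphism.\<close>

lemma local_lift:
  assumes f: "regular_epi C f" "f \<in> hom C X Y" and c: "c \<in> hom C A Y"
  obtains B e x where "regular_epi C e" "e \<in> hom C B A" "x \<in> hom C B X" "f \<cdot> x = c \<cdot> e"
proof -
  obtain B e x where pb: "is_pullback C c f B e x"
    using pullback_exists[OF c f(2)] by blast
  then have "e \<in> hom C B A" "x \<in> hom C B X" "f \<cdot> x = c \<cdot> e"
    unfolding is_pullback_def homD(2)[OF c] homD(2)[OF f(2)] by simp_all
  then show ?thesis
    using that regular_epi_pullback[OF f(1) pb] by blast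
qed

text \<open>The elementwise form of descent: to relate two elements, one may assume that a given element
  \<open>c\<close> of \<open>Y\<close> has a preimage under \<open>f\<close>. Restriction along \<open>e\<close> is the change of stage that this
  costs.\<close>

lemma hom_relation_local:
  assumes R: "R \<in> relations C Z" and ab: "a \<in> hom C A Z" "b \<in> hom C A Z"
    and f: "regular_epi C f" "f \<in> hom C X Y" and c: "c \<in> hom C A Y"
    and local: "\<And>B e x. e \<in> hom C B A \<Longrightarrow> x \<in> hom C B X \<Longrightarrow> f \<cdot> x = c \<cdot> e \<Longrightarrow>
      (a \<cdot> e, b \<cdot> e) \<in> hom_relation C Z R B"
  shows "(a, b) \<in> hom_relation C Z R A"
proof -
  obtain B e x where "regular_epi C e" "e \<in> hom C B A" "x \<in> hom C B X" "f \<cdot> x = c \<cdot> e"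
    using local_lift[OF f c] .
  then show ?thesis
    using hom_relation_descend[OF homD(5)[OF ab(1)] R _ _ ab] local by blast
qed

lemma hom_relation_local2:
  assumes R: "R \<in> relations C Z" and ab: "a \<in> hom C A Z" "b \<in> hom C A Z"
    and f: "regular_epi C f" "f \<in> hom C X Y" and c: "c \<in> hom C A Y" and d: "d \<in> hom C A Y"
    and local: "\<And>B e x y. e \<in> hom C B A \<Longrightarrow> x \<in> hom C B X \<Longrightarrow> y \<in> hom C B X \<Longrightarrow>
      f \<cdot> x = c \<cdot> e \<Longrightarrow> f \<cdot> y = d \<cdot> e \<Longrightarrow> (a \<cdot> e, b \<cdot> e) \<in> hom_relation C Z R B"
  shows "(a, b) \<in> hom_relation C Z R A"
proof (rule hom_relation_local[OF R ab f c])
  fix B e x assume e: "e \<in> hom C B A" and x: "x \<in> hom C B X" "f \<cdot> x = c \<cdot> e"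
  show "(a \<cdot> e, b \<cdot> e) \<in> hom_relation C Z R B"
  proof (rule hom_relation_local[OF R cmp_hom[OF e ab(1)] cmp_hom[OF e ab(2)] f cmp_hom[OF e d]])
    fix B' e' y assume e': "e' \<in> hom C B' B" and y: "y \<in> hom C B' X" "f \<cdot> y = (d \<cdot> e) \<cdot> e'"
    have "f \<cdot> (x \<cdot> e') = c \<cdot> (e \<cdot> e')"
      using cmp_eqD[OF x(2,1) f(2) e'] cmp_assoc[OF e' e c] by simp
    moreover have "f \<cdot> y = d \<cdot> (e \<cdot> e')"
      using y(2) cmp_assoc[OF e' e d] by simp
    ultimately have "(a \<cdot> (e \<cdot> e'), b \<cdot> (e \<cdot> e')) \<in> hom_relation C Z R B'"
      using local[OF cmp_hom[OF e' e] cmp_hom[OF e' x(1)] y(1)] by blast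
    then show "((a \<cdot> e) \<cdot> e', (b \<cdot> e) \<cdot> e') \<in> hom_relation C Z R B'"
      using cmp_assoc[OF e' e ab(1)] cmp_assoc[OF e' e ab(2)] by simp
  qed
qed

lemma subobject_le_descend:
  assumes f: "regular_epi C f" "f \<in> hom C X Y" and S: "S \<in> relations C Y" and W: "W \<in> relations C Y"
    and le: "subobject_le C (inverse_image C f S) (inverse_image C f W)"
  shows "subobject_le C S W"
  unfolding subobject_le_iff[OF homD(5)[OF f(2)] S W]
proof (intro allI impI)
  note X = homD(4)[OF f(2)] and Y = homD(5)[OF f(2)]
  fix A a b assume ab: "(a, b) \<in> hom_relation C Y S A"
  note h = hom_relation_hom[OF Y S ab]
  show "(a, b) \<in> hom_relation C Y W A"
  proof (rule hom_relation_local2[OF W h f h])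
    fix B e x y assume e: "e \<in> hom C B A" and xy: "x \<in> hom C B X" "y \<in> hom C B X"
      and eq: "f \<cdot> x = a \<cdot> e" "f \<cdot> y = b \<cdot> e"
    have "(x, y) \<in> hom_relation C X (inverse_image C f S) B"
      using hom_relation_restrict[OF Y S ab e] xy eq by (simp add: inverse_image(2)[OF f(2) S])
    then have "(x, y) \<in> hom_relation C X (inverse_image C f W) B"
      using le unfolding subobject_le_iff[OF X inverse_image(1)[OF f(2) S] inverse_image(1)[OF f(2) W]]
      by blast
    then show "(a \<cdot> e, b \<cdot> e) \<in> hom_relation C Y W B"
      using eq by (simp add: inverse_image(2)[OF f(2) W])
  qed
qed

text \<open>Each axiom for \<open>S\<close> follows by lifting the elements that it mentions to \<open>X\<close>, where
  \<open>f\<^sup>-\<^sup>1(S)\<close> satisfies it. For transitivity it is essential that the same lift of the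
  middle element serves both hypotheses.\<close>

lemma preorder_descend:
  assumes f: "regular_epi C f" "f \<in> hom C X Y" and S: "S \<in> relations C Y"
    and Q: "inverse_image C f S \<in> preorder_rels C X"
  shows "S \<in> preorder_rels C Y"
proof (rule preorder_relsI[OF _ S])
  note X = homD(4)[OF f(2)]
  show Y: "Y \<in> obj C"
    by (rule homD(5)[OF f(2)])
  note D = preorder_relsD[OF X Q, unfolded inverse_image(2)[OF f(2) S]]
  show "(a, a) \<in> hom_relation C Y S A" if a: "a \<in> hom C A Y" for A a
  proof (rule hom_relation_local[OF S a a f a])
    fix B e x assume "x \<in> hom C B X" "f \<cdot> x = a \<cdot> e"
    then show "(a \<cdot> e, a \<cdot> e) \<in> hom_relation C Y S B"
      using D(2) by metis
  qed
  fix A a b c assume ab: "(a, b) \<in> hom_relation C Y S A" and bc: "(b, c) \<in> hom_relation C Y S A"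
  note h = hom_relation_hom[OF Y S ab] hom_relation_hom[OF Y S bc]
  show "(a, c) \<in> hom_relation C Y S A"
  proof (rule hom_relation_local2[OF S h(1,4) f h(1,4)])
    fix B e x z assume e: "e \<in> hom C B A" and xz: "x \<in> hom C B X" "z \<in> hom C B X"
      "f \<cdot> x = a \<cdot> e" "f \<cdot> z = c \<cdot> e"
    note he = cmp_hom[OF e h(1)] cmp_hom[OF e h(4)] cmp_hom[OF e h(2)]
    note abc = hom_relation_restrict[OF Y S ab e] hom_relation_restrict[OF Y S bc e]
    show "(a \<cdot> e, c \<cdot> e) \<in> hom_relation C Y S B"
    proof (rule hom_relation_local[OF S he(1,2) f he(3)])
      fix B' e' y assume e': "e' \<in> hom C B' B" and y: "y \<in> hom C B' X" "f \<cdot> y = (b \<cdot> e) \<cdot> e'"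
      note eq = cmp_eqD[OF xz(3,1) f(2) e'] cmp_eqD[OF xz(4,2) f(2) e'] y(2)
      have "(f \<cdot> (x \<cdot> e'), f \<cdot> y) \<in> hom_relation C Y S B'"
        "(f \<cdot> y, f \<cdot> (z \<cdot> e')) \<in> hom_relation C Y S B'"
        unfolding eq using hom_relation_restrict[OF Y S _ e'] abc by blast+
      then have "(f \<cdot> (x \<cdot> e'), f \<cdot> (z \<cdot> e')) \<in> hom_relation C Y S B'"
        using D(3)[of "x \<cdot> e'" B' y "z \<cdot> e'"] cmp_hom[OF e' xz(1)] cmp_hom[OF e' xz(2)] y(1) by blast
      then show "((a \<cdot> e) \<cdot> e', (c \<cdot> e) \<cdot> e') \<in> hom_relation C Y S B'"
        unfolding eq .
    qed
  qed
qed

lemma equivalence_descend: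
  assumes f: "regular_epi C f" "f \<in> hom C X Y" and S: "S \<in> relations C Y"
    and Q: "inverse_image C f S \<in> equivalence_rels C X"
  shows "S \<in> equivalence_rels C Y"
proof -
  note X = homD(4)[OF f(2)] and Y = homD(5)[OF f(2)]
  have sym: "(f \<cdot> x, f \<cdot> y) \<in> hom_relation C Y S A \<Longrightarrow> (f \<cdot> y, f \<cdot> x) \<in> hom_relation C Y S A"
    if "x \<in> hom C A X" "y \<in> hom C A X" for x y A
    using Q that unfolding equivalence_rels_iff[OF X] inverse_image(2)[OF f(2) S] by blast
  have "(b, a) \<in> hom_relation C Y S A" if ab: "(a, b) \<in> hom_relation C Y S A" for A a b
  proof -
    note h = hom_relation_hom[OF Y S ab]
    show ?thesis
    proof (rule hom_relation_local2[OF S h(2,1) f h])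
      fix B e x y assume e: "e \<in> hom C B A" and xy: "x \<in> hom C B X" "y \<in> hom C B X"
        "f \<cdot> x = a \<cdot> e" "f \<cdot> y = b \<cdot> e"
      then show "(b \<cdot> e, a \<cdot> e) \<in> hom_relation C Y S B"
        using sym[OF xy(1,2)] hom_relation_restrict[OF Y S ab e] by simp
    qed
  qed
  then show ?thesis
    using preorder_descend[OF f S] Q unfolding equivalence_rels_iff[OF X] equivalence_rels_iff[OF Y]
    by blast
qed

text \<open>The witness is the image of \<open>Q\<close> under \<open>f \<times> f\<close>. If \<open>(f x, f y)\<close> lies in it, then locally
  \<open>f x = f x'\<close> and \<open>f y = f y'\<close> for some \<open>x' Q y'\<close>, and \<open>Q\<close> absorbs the two kernel steps in
  \<open>x ~ x' Q y' ~ y\<close>.\<close>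

lemma saturated_is_inverse_image:
  assumes f: "regular_epi C f" "f \<in> hom C X Y" and Q: "Q \<in> preorder_rels C X"
    and ker: "subobject_le C (kernel f) Q"
  shows "\<exists>S\<in>relations C Y. inverse_image C f S = Q"
proof -
  note X = homD(4)[OF f(2)] and Y = homD(5)[OF f(2)]
  note D = preorder_relsD[OF X Q]
  note F = sq_map(1)[OF f(2)]
  obtain q where q: "q \<in> Q"
    using relations_nonempty[OF D(1)] by blast
  note qh = relations_rep(2)[OF D(1) q]
  obtain e m where e: "regular_epi C e" and m: "is_mono C m" "tgt C e = src C m"
    and fac: "sq_map C f \<cdot> q = m \<cdot> e"
    using regular_epi_mono_factorization[OF homD(1)[OF cmp_hom[OF qh F]]] by blast
  have earr: "e \<in> arr C"
    using e by (auto simp: regular_epi_def is_coequalizer_def)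
  have eh: "e \<in> hom C (src C q) (src C m)" and mh: "m \<in> hom C (src C m) (sq C Y)"
    using cmp_hom[OF qh F] earr m mono_hom[OF m(1)] fac by (auto simp: hom_def cat_simps)
  define S where "S = subobject_class C m"
  have S: "S \<in> relations C Y" and mS: "m \<in> S"
    unfolding S_def using m(1) mh mono_mem_subobject_class
    by (auto intro!: subobject_class_relation simp: hom_def)
  note I = inverse_image[OF f(2) S]
  have image: "pr0 C Y \<cdot> m \<cdot> (e \<cdot> h) = f \<cdot> pr0 C X \<cdot> q \<cdot> h" "pr1 C Y \<cdot> m \<cdot> (e \<cdot> h) = f \<cdot> pr1 C X \<cdot> q \<cdot> h"
    if h: "h \<in> hom C A (src C q)" for A h
  proof -
    have "m \<cdot> (e \<cdot> h) = sq_map C f \<cdot> (q \<cdot> h)"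
      using cmp_eqD[OF fac[symmetric] eh mh h] cmp_assoc[OF h qh F] by simp
    then show "pr0 C Y \<cdot> m \<cdot> (e \<cdot> h) = f \<cdot> pr0 C X \<cdot> q \<cdot> h" "pr1 C Y \<cdot> m \<cdot> (e \<cdot> h) = f \<cdot> pr1 C X \<cdot> q \<cdot> h"
      using sq_map(2,3)[OF f(2) cmp_hom[OF h qh]] by simp_all
  qed
  have "inverse_image C f S = Q"
  proof (rule subobject_le_antisym[OF I(1) D(1)])
    show "subobject_le C Q (inverse_image C f S)"
      unfolding subobject_le_iff[OF X D(1) I(1)]
    proof (intro allI impI)
      fix A a b assume ab: "(a, b) \<in> hom_relation C X Q A"
      then obtain h where h: "h \<in> hom C A (src C q)" "pr0 C X \<cdot> q \<cdot> h = a" "pr1 C X \<cdot> q \<cdot> h = b"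
        unfolding mem_hom_relation_iff[OF X D(1) q] by blast
      then have "(f \<cdot> a, f \<cdot> b) \<in> hom_relation C Y S A"
        unfolding mem_hom_relation_iff[OF Y S mS] using image[OF h(1)] cmp_hom[OF h(1) eh] by blast
      then show "(a, b) \<in> hom_relation C X (inverse_image C f S) A"
        using hom_relation_hom[OF X D(1) ab] by (simp add: I(2))
    qed
    show "subobject_le C (inverse_image C f S) Q"
      unfolding subobject_le_iff[OF X I(1) D(1)]
    proof (intro allI impI)
      fix A x y assume xy: "(x, y) \<in> hom_relation C X (inverse_image C f S) A"
      then have h: "x \<in> hom C A X" "y \<in> hom C A X"
        by (auto simp: I(2))
      obtain k where k: "k \<in> hom C A (src C m)" "pr0 C Y \<cdot> m \<cdot> k = f \<cdot> x" "pr1 C Y \<cdot> m \<cdot> k = f \<cdot> y"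
        using xy unfolding I(2) mem_hom_relation_iff[OF Y S mS] by blast
      show "(x, y) \<in> hom_relation C X Q A"
      proof (rule hom_relation_local[OF D(1) h e eh k(1)])
        fix B d l assume d: "d \<in> hom C B A" and l: "l \<in> hom C B (src C q)" "e \<cdot> l = k \<cdot> d"
        define x' where "x' = pr0 C X \<cdot> q \<cdot> l"
        define y' where "y' = pr1 C X \<cdot> q \<cdot> l"
        have xy': "(x', y') \<in> hom_relation C X Q B"
          unfolding mem_hom_relation_iff[OF X D(1) q] x'_def y'_def using l(1) by blast
        note h' = hom_relation_hom[OF X D(1) xy']
        have "f \<cdot> x' = (pr0 C Y \<cdot> m \<cdot> k) \<cdot> d" "f \<cdot> y' = (pr1 C Y \<cdot> m \<cdot> k) \<cdot> d"
          unfolding x'_def y'_def image[OF l(1), symmetric] l(2)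
          using mh k(1) d by (auto simp: hom_def cat_simps pr_arr[OF Y])
        then have "f \<cdot> (x \<cdot> d) = f \<cdot> x'" "f \<cdot> y' = f \<cdot> (y \<cdot> d)"
          unfolding k using cmp_assoc[OF d h(1) f(2)] cmp_assoc[OF d h(2) f(2)] by simp_all
        then have "(x \<cdot> d, x') \<in> hom_relation C X (kernel f) B" "(y', y \<cdot> d) \<in> hom_relation C X (kernel f) B"
          using h' cmp_hom[OF d h(1)] cmp_hom[OF d h(2)] by (auto simp: hom_relation_kernel[OF f(2)])
        moreover have "kernel f \<in> relations C X"
          using kernel_equivalence[OF f(2)] preorder_relsD(1)[OF X] by (simp add: equivalence_rels_iff[OF X])
        ultimately have "(x \<cdot> d, x') \<in> hom_relation C X Q B" "(y', y \<cdot> d) \<in> hom_relation C X Q B"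
          using ker D(1) by (auto simp: subobject_le_iff[OF X])
        then show "(x \<cdot> d, y \<cdot> d) \<in> hom_relation C X Q B"
          using D(3) xy' by blast
      qed
    qed
  qed
  then show ?thesis
    using S by blast
qed

end


section \<open>Cocartesian maps and suprema\<close>

text \<open>This locale treats preorders and equivalence relations at once. These axioms are what the
  passage between suprema and cocartesian maps uses of either class: equivalence relations belong to
  \<open>K\<close> so that kernels and the given \<open>R\<close> do, and inverse images supply \<open>d\<^sub>0\<^sup>-\<^sup>1(S)\<close> and
  \<open>s\<^sup>-\<^sup>1(Q)\<close>.\<close>

locale relation_class = finitely_complete +
  fixes K :: "'a \<Rightarrow> 'b set set"
  assumes class_preorder: "R \<in> K X \<Longrightarrow> R \<in> preorder_rels C X"
    and equivalence_class: "R \<in> equivalence_rels C X \<Longrightarrow> R \<in> K X"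
    and inverse_image_class: "f \<in> hom C X Y \<Longrightarrow> S \<in> K Y \<Longrightarrow> inverse_image C f S \<in> K X"
begin

abbreviation "Rel \<equiv> full_subcat (Ref C) (\<lambda>(X, R). R \<in> K X)"

lemma class_rel: "X \<in> obj C \<Longrightarrow> R \<in> K X \<Longrightarrow> R \<in> relations C X"
  using class_preorder preorder_relsD(1) by blast

lemma class_reflexive: "R \<in> K X \<Longrightarrow> R \<in> reflexive_rels C X"
  using class_preorder by (auto simp: preorder_rels_def)

lemma Rel_obj: "(X, R) \<in> obj Rel \<longleftrightarrow> X \<in> obj C \<and> R \<in> K X"
  using class_reflexive by (auto simp: full_subcat_def Ref_def)

lemma Rel_arr: "((X, R), f, (Y, S)) \<in> arr Rel \<longleftrightarrow>
    R \<in> K X \<and> S \<in> K Y \<and> f \<in> hom C X Y \<and> subobject_le C R (inverse_image C f S)"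
  using class_reflexive homD by (auto simp: full_subcat_def Ref_def)

lemma Rel_sel: "src Rel (x, f, y) = x" "tgt Rel (x, f, y) = y"
  "cmp Rel (y', g, z) (x, f, y) = (x, g \<cdot> f, z)" "farr ground (x, f, y) = f" "fobj ground x = fst x"
  by (simp_all add: full_subcat_def Ref_def ground_def)

text \<open>Morphisms of relations above \<open>f\<close> are unique if they exist, so the universal property is one of
  posets: the codomain of a cocartesian map is the value at \<open>T\<close> of a left adjoint to inverse image
  along \<open>f\<close>.\<close>

lemma has_cocartesian_above_iff:
  assumes f: "f \<in> hom C X Y" and T: "T \<in> K X"
  shows "has_cocartesian_above Rel C ground f (X, T) \<longleftrightarrow>
    (\<exists>S\<in>K Y. \<forall>W\<in>K Y. subobject_le C S W \<longleftrightarrow> subobject_le C T (inverse_image C f W))"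
proof
  note X = homD(4)[OF f] and Y = homD(5)[OF f]
  note rX = class_rel[OF X] and rY = class_rel[OF Y]
  {
    assume "has_cocartesian_above Rel C ground f (X, T)"
    then obtain k where k: "cocartesian Rel C ground k" "src Rel k = (X, T)" "farr ground k = f"
      by (auto simp: has_cocartesian_above_def)
    obtain x f' Y' S where keq: "k = (x, f', (Y', S))"
      by (metis prod.collapse)
    have keq': "k = ((X, T), f, (Y', S))"
      using k keq by (simp add: Rel_sel)
    have karr: "k \<in> arr Rel"
      using k(1) by (simp add: cocartesian_def)
    then have S: "S \<in> K Y" and Y': "Y' = Y" and TS: "subobject_le C T (inverse_image C f S)"
      using f by (auto simp: keq' Rel_arr hom_def)
    note keq'' = keq'[unfolded Y']
    have "subobject_le C S W \<longleftrightarrow> subobject_le C T (inverse_image C f W)" if W: "W \<in> K Y" for W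
    proof
      assume "subobject_le C S W"
      then show "subobject_le C T (inverse_image C f W)"
        using inverse_image_mono[OF f rY[OF S] rY[OF W]] TS
          subobject_le_trans[OF X rX[OF T] inverse_image(1)[OF f rY[OF S]] inverse_image(1)[OF f rY[OF W]]]
        by blast
    next
      assume "subobject_le C T (inverse_image C f W)"
      then have "((X, T), f, (Y, W)) \<in> arr Rel"
        using T W f by (simp add: Rel_arr)
      then obtain \<psi> where \<psi>: "\<psi> \<in> hom Rel (Y, S) (Y, W)" "farr ground \<psi> = idn C Y"
        using k(1) unfolding cocartesian_def keq'' by (fastforce simp: Rel_sel)
      obtain y g w where "\<psi> = (y, g, w)"
        by (metis prod.collapse)
      then have "((Y, S), idn C Y, (Y, W)) \<in> arr Rel"
        using \<psi> by (auto simp: hom_def Rel_sel)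
      then show "subobject_le C S W"
        using inverse_image_idn[OF Y rY[OF W]] by (simp add: Rel_arr)
    qed
    then show "\<exists>S\<in>K Y. \<forall>W\<in>K Y. subobject_le C S W \<longleftrightarrow> subobject_le C T (inverse_image C f W)"
      using S by blast
  }
  assume "\<exists>S\<in>K Y. \<forall>W\<in>K Y. subobject_le C S W \<longleftrightarrow> subobject_le C T (inverse_image C f W)"
  then obtain S where S: "S \<in> K Y"
    and adj: "\<And>W. W \<in> K Y \<Longrightarrow> subobject_le C S W \<longleftrightarrow> subobject_le C T (inverse_image C f W)"
    by blast
  have "cocartesian Rel C ground ((X, T), f, (Y, S))"
    unfolding cocartesian_def
  proof (intro conjI ballI impI)
    show "((X, T), f, (Y, S)) \<in> arr Rel"
      using T S f adj[OF S] subobject_le_refl[OF Y rY[OF S]] by (simp add: Rel_arr)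
    fix \<phi> assume \<phi>: "\<phi> \<in> arr Rel"
      and eq: "src Rel \<phi> = src Rel ((X, T), f, (Y, S)) \<and> farr ground \<phi> = farr ground ((X, T), f, (Y, S))"
    obtain x g Y' W where "\<phi> = (x, g, (Y', W))"
      by (metis prod.collapse)
    then have \<phi>': "\<phi> = ((X, T), f, (Y, W))"
      using eq \<phi> f by (cases x) (auto simp: Rel_sel Rel_arr hom_def)
    then have W: "W \<in> K Y" "subobject_le C T (inverse_image C f W)"
      using \<phi> by (auto simp: Rel_arr)
    have \<psi>: "((Y, S), idn C Y, (Y, W)) \<in> arr Rel"
      using S W adj[OF W(1)] idn_hom[OF Y] inverse_image_idn[OF Y rY[OF W(1)]] by (simp add: Rel_arr)
    show "\<exists>!\<psi>. \<psi> \<in> hom Rel (tgt Rel ((X, T), f, (Y, S))) (tgt Rel \<phi>) \<and>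
        cmp Rel \<psi> ((X, T), f, (Y, S)) = \<phi> \<and>
        farr ground \<psi> = idn C (fobj ground (tgt Rel ((X, T), f, (Y, S))))"
      unfolding \<phi>' Rel_sel fst_conv
    proof (rule ex1I[of _ "((Y, S), idn C Y, (Y, W))"])
      show "((Y, S), idn C Y, Y, W) \<in> hom Rel (Y, S) (Y, W) \<and>
          cmp Rel ((Y, S), idn C Y, Y, W) ((X, T), f, Y, S) = ((X, T), f, Y, W) \<and>
          farr ground ((Y, S), idn C Y, Y, W) = idn C Y"
        using \<psi> idn_cmp[OF f] by (simp add: hom_def Rel_sel)
      fix \<psi>' assume "\<psi>' \<in> hom Rel (Y, S) (Y, W) \<and> cmp Rel \<psi>' ((X, T), f, Y, S) = ((X, T), f, Y, W) \<and>
          farr ground \<psi>' = idn C Y"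
      then show "\<psi>' = ((Y, S), idn C Y, Y, W)"
        by (cases \<psi>') (auto simp: hom_def Rel_sel)
    qed
  qed
  then show "has_cocartesian_above Rel C ground f (X, T)"
    unfolding has_cocartesian_above_def by (intro exI[of _ "((X, T), f, (Y, S))"]) (simp add: Rel_sel)
qed

lemma has_supremum_iff:
  assumes X: "X \<in> obj C" and R: "R \<in> K X" and S: "S \<in> K X"
  shows "has_supremum C (K X) R S \<longleftrightarrow>
    (\<exists>Q\<in>K X. \<forall>W\<in>K X. subobject_le C Q W \<longleftrightarrow> subobject_le C R W \<and> subobject_le C S W)"
proof -
  note r = class_rel[OF X]
  have "has_supremum C (K X) R S \<longleftrightarrow>
    (\<exists>Q\<in>K X. subobject_le C R Q \<and> subobject_le C S Q \<and>
      (\<forall>W\<in>K X. subobject_le C R W \<and> subobject_le C S W \<longrightarrow> subobject_le C Q W))"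
    using R S by (auto simp: has_supremum_def least_def Upper_def)
  then show ?thesis
    using subobject_le_refl[OF X r] subobject_le_trans[OF X r[OF R] r r]
      subobject_le_trans[OF X r[OF S] r r] by blast
qed

text \<open>The supremum is the direct image along \<open>d\<^sub>1\<close> of \<open>d\<^sub>0\<^sup>-\<^sup>1(S)\<close>, for the two legs of \<open>R\<close>; its
  upper bounds \<open>W\<close> are those with \<open>y W y'\<close> whenever \<open>y R x S x' R y'\<close>.\<close>

lemma supremum_if_cocartesian_above_split_epis:
  assumes cocart: "\<And>f T. split_epi C f \<Longrightarrow> T \<in> obj Rel \<Longrightarrow> fobj ground T = src C f \<Longrightarrow>
      has_cocartesian_above Rel C ground f T"
    and X: "X \<in> obj C" and R: "R \<in> equivalence_rels C X" and S: "S \<in> K X"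
  shows "has_supremum C (K X) R S"
proof -
  have RK: "R \<in> K X"
    by (rule equivalence_class[OF R])
  note rR = class_rel[OF X RK] and rS = class_rel[OF X S]
  note DR = preorder_relsD[OF X class_preorder[OF RK]]
  note DS = preorder_relsD[OF X class_preorder[OF S]]
  obtain m where m: "m \<in> R"
    using relations_nonempty[OF rR] by blast
  note mh = relations_rep(2)[OF rR m]
  note mem = mem_hom_relation_iff[OF X rR m]
  define d0 where "d0 = pr0 C X \<cdot> m"
  define d1 where "d1 = pr1 C X \<cdot> m"
  have d: "d0 \<in> hom C (src C m) X" "d1 \<in> hom C (src C m) X"
    unfolding d0_def d1_def using cmp_hom[OF mh] pr_hom[OF X] by blast+
  have dk: "d0 \<cdot> k = pr0 C X \<cdot> m \<cdot> k" "d1 \<cdot> k = pr1 C X \<cdot> m \<cdot> k" if "k \<in> hom C A (src C m)" for A k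
    unfolding d0_def d1_def using cmp_assoc[OF that mh] pr_hom[OF X] by blast+
  have mem': "(a, b) \<in> hom_relation C X R A \<longleftrightarrow> (\<exists>k\<in>hom C A (src C m). d0 \<cdot> k = a \<and> d1 \<cdot> k = b)"
    for a b A
    unfolding mem by (intro bex_cong) (auto simp: dk)
  \<comment> \<open>reflexivity of \<open>R\<close> at the generic element of \<open>X\<close> is a common section of the two legs\<close>
  obtain s where s: "s \<in> hom C X (src C m)" "d1 \<cdot> s = idn C X"
    using DR(2)[OF idn_hom[OF X]] unfolding mem' by blast
  then have split: "split_epi C d1"
    using d(2) by (auto simp: split_epi_def hom_def)
  define T where "T = inverse_image C d0 S"
  have T: "T \<in> K (src C m)"
    unfolding T_def by (rule inverse_image_class[OF d(1) S])
  have "(src C m, T) \<in> obj Rel"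
    using T homD(4)[OF mh] by (simp add: Rel_obj)
  moreover have "fobj ground (src C m, T) = src C d1"
    using homD(2)[OF d(2)] by (simp add: Rel_sel)
  ultimately have "has_cocartesian_above Rel C ground d1 (src C m, T)"
    by (rule cocart[OF split])
  then obtain Q where Q: "Q \<in> K X"
    and adj: "\<And>W. W \<in> K X \<Longrightarrow> subobject_le C Q W \<longleftrightarrow> subobject_le C T (inverse_image C d1 W)"
    unfolding has_cocartesian_above_iff[OF d(2) T] by blast
  have "subobject_le C T (inverse_image C d1 W) \<longleftrightarrow> subobject_le C R W \<and> subobject_le C S W"
    if W: "W \<in> K X" for W
  proof -
    note rW = class_rel[OF X W]
    note DW = preorder_relsD[OF X class_preorder[OF W]]
    note I0 = inverse_image[OF d(1) rS, folded T_def] and I1 = inverse_image[OF d(2) rW]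
    have "subobject_le C T (inverse_image C d1 W) \<longleftrightarrow>
      (\<forall>A. \<forall>k\<in>hom C A (src C m). \<forall>l\<in>hom C A (src C m).
        (d0 \<cdot> k, d0 \<cdot> l) \<in> hom_relation C X S A \<longrightarrow> (d1 \<cdot> k, d1 \<cdot> l) \<in> hom_relation C X W A)"
      unfolding subobject_le_iff[OF homD(4)[OF mh] I0(1) I1(1)] I0(2) I1(2) by blast
    also have "\<dots> \<longleftrightarrow> (\<forall>A x y x' y'. (x, y) \<in> hom_relation C X R A \<longrightarrow> (x', y') \<in> hom_relation C X R A \<longrightarrow>
        (x, x') \<in> hom_relation C X S A \<longrightarrow> (y, y') \<in> hom_relation C X W A)"
      unfolding mem' by blast
    also have "\<dots> \<longleftrightarrow> subobject_le C R W \<and> subobject_le C S W"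
      unfolding subobject_le_iff[OF X rR rW] subobject_le_iff[OF X rS rW]
    proof (intro iffI conjI allI impI)
      fix A a b
      assume *: "\<forall>A x y x' y'. (x, y) \<in> hom_relation C X R A \<longrightarrow> (x', y') \<in> hom_relation C X R A \<longrightarrow>
          (x, x') \<in> hom_relation C X S A \<longrightarrow> (y, y') \<in> hom_relation C X W A"
      { assume ab: "(a, b) \<in> hom_relation C X R A"
        note a = hom_relation_hom(1)[OF X rR ab]
        \<comment> \<open>apply the hypothesis to \<open>a R a\<close>, \<open>a R b\<close> and \<open>a S a\<close>\<close>
        show "(a, b) \<in> hom_relation C X W A"
          using * DR(2)[OF a] ab DS(2)[OF a] by blast }
      { assume ab: "(a, b) \<in> hom_relation C X S A"
        \<comment> \<open>apply the hypothesis to \<open>a R a\<close>, \<open>b R b\<close> and \<open>a S b\<close>\<close>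
        show "(a, b) \<in> hom_relation C X W A"
          using * DR(2)[OF hom_relation_hom(1)[OF X rS ab]] DR(2)[OF hom_relation_hom(2)[OF X rS ab]] ab
          by blast }
    next
      fix A x y x' y'
      assume le: "(\<forall>A a b. (a, b) \<in> hom_relation C X R A \<longrightarrow> (a, b) \<in> hom_relation C X W A) \<and>
          (\<forall>A a b. (a, b) \<in> hom_relation C X S A \<longrightarrow> (a, b) \<in> hom_relation C X W A)"
        and xy: "(x, y) \<in> hom_relation C X R A" "(x', y') \<in> hom_relation C X R A"
        and S: "(x, x') \<in> hom_relation C X S A"
      have "(y, x) \<in> hom_relation C X R A"
        using R xy(1) by (simp add: equivalence_rels_iff[OF X])
      then show "(y, y') \<in> hom_relation C X W A"
        using le xy(2) S DW(3) by blast
    qed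
    finally show ?thesis .
  qed
  then show ?thesis
    unfolding has_supremum_iff[OF X RK S] using Q adj by blast
qed

text \<open>The part that split and regular epimorphisms share. Inverse images of reflexive relations
  along \<open>f\<close> contain the kernel, so they cannot tell \<open>T\<close> from its supremum with the kernel; the last
  two hypotheses then transport that supremum to \<open>Y\<close>.\<close>

lemma cocartesian_above_if_supremum:
  assumes sup: "has_supremum C (K X) (kernel f) T"
    and f: "f \<in> hom C X Y" and T: "T \<in> K X"
    and quotient: "\<And>Q. Q \<in> K X \<Longrightarrow> subobject_le C (kernel f) Q \<Longrightarrow> \<exists>S\<in>K Y. inverse_image C f S = Q"
    and reflect: "\<And>S W. S \<in> K Y \<Longrightarrow> W \<in> K Y \<Longrightarrow>
      subobject_le C (inverse_image C f S) (inverse_image C f W) \<Longrightarrow> subobject_le C S W"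
  shows "has_cocartesian_above Rel C ground f (X, T)"
proof -
  note X = homD(4)[OF f] and Y = homD(5)[OF f]
  note rY = class_rel[OF Y]
  have ker: "kernel f \<in> K X"
    by (rule equivalence_class[OF kernel_equivalence[OF f]])
  obtain Q where Q: "Q \<in> K X"
    and le: "\<And>W. W \<in> K X \<Longrightarrow> subobject_le C Q W \<longleftrightarrow> subobject_le C (kernel f) W \<and> subobject_le C T W"
    using sup unfolding has_supremum_iff[OF X ker T] by blast
  have "subobject_le C (kernel f) Q"
    using le[OF Q] subobject_le_refl[OF X class_rel[OF X Q]] by blast
  then obtain S where S: "S \<in> K Y" "inverse_image C f S = Q"
    using quotient[OF Q] by blast
  have "subobject_le C S W \<longleftrightarrow> subobject_le C T (inverse_image C f W)" if W: "W \<in> K Y" for W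
  proof -
    have "subobject_le C (diagonal C Y) W"
      using class_reflexive[OF W] by (simp add: reflexive_rels_def)
    then have "subobject_le C (kernel f) (inverse_image C f W)"
      using inverse_image_mono[OF f diagonal(1)[OF Y] rY[OF W]] homD(3)[OF f] by (simp add: kernel_def)
    moreover have "subobject_le C S W \<longleftrightarrow> subobject_le C Q (inverse_image C f W)"
      using reflect[OF S(1) W] inverse_image_mono[OF f rY[OF S(1)] rY[OF W]] S(2) by blast
    ultimately show ?thesis
      using le[OF inverse_image_class[OF f W]] by blast
  qed
  then show ?thesis
    unfolding has_cocartesian_above_iff[OF f T] using S(1) by blast
qed

text \<open>For a section \<open>s\<close> of \<open>f\<close>, inverse image along \<open>s\<close> undoes inverse image along \<open>f\<close>, so the
  latter reflects inclusions. On relations \<open>Q\<close> containing the kernel it is also a right inverse,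
  since such a \<open>Q\<close> relates \<open>x\<close> and \<open>s (f x)\<close> both ways.\<close>

lemma cocartesian_above_split_epi:
  assumes sup: "has_supremum C (K X) (kernel f) T"
    and f: "split_epi C f" "f \<in> hom C X Y" and T: "T \<in> K X"
  shows "has_cocartesian_above Rel C ground f (X, T)"
proof (rule cocartesian_above_if_supremum[OF sup f(2) T])
  note X = homD(4)[OF f(2)] and Y = homD(5)[OF f(2)]
  note rX = class_rel[OF X] and rY = class_rel[OF Y]
  obtain s where s: "s \<in> hom C Y X" "f \<cdot> s = idn C Y"
    using f(1) homD[OF f(2)] by (auto simp: split_epi_def)
  have fs: "f \<cdot> (s \<cdot> a) = a" if "a \<in> hom C A Y" for A a
    using cmp_eqD[OF s(2,1) f(2) that] idn_cmp[OF that] by simp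
  {
    fix S W assume S: "S \<in> K Y" and W: "W \<in> K Y"
      and le: "subobject_le C (inverse_image C f S) (inverse_image C f W)"
    note IS = inverse_image[OF f(2) rY[OF S]] and IW = inverse_image[OF f(2) rY[OF W]]
    show "subobject_le C S W"
      unfolding subobject_le_iff[OF Y rY[OF S] rY[OF W]]
    proof (intro allI impI)
      fix A a b assume ab: "(a, b) \<in> hom_relation C Y S A"
      note h = hom_relation_hom[OF Y rY[OF S] ab]
      have "(s \<cdot> a, s \<cdot> b) \<in> hom_relation C X (inverse_image C f S) A"
        using ab cmp_hom[OF h(1) s(1)] cmp_hom[OF h(2) s(1)] by (simp add: IS(2) fs[OF h(1)] fs[OF h(2)])
      then have "(s \<cdot> a, s \<cdot> b) \<in> hom_relation C X (inverse_image C f W) A"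
        using le unfolding subobject_le_iff[OF X IS(1) IW(1)] by blast
      then show "(a, b) \<in> hom_relation C Y W A"
        by (simp add: IW(2) fs[OF h(1)] fs[OF h(2)])
    qed
  }
  fix Q assume Q: "Q \<in> K X" and ker: "subobject_le C (kernel f) Q"
  define S where "S = inverse_image C s Q"
  have S: "S \<in> K Y"
    unfolding S_def by (rule inverse_image_class[OF s(1) Q])
  note D = preorder_relsD[OF X class_preorder[OF Q]]
  note IQ = inverse_image[OF s(1) rX[OF Q], folded S_def] and IS = inverse_image[OF f(2) rY[OF S]]
  have kerQ: "(x, s \<cdot> (f \<cdot> x)) \<in> hom_relation C X Q A" "(s \<cdot> (f \<cdot> x), x) \<in> hom_relation C X Q A"
    if x: "x \<in> hom C A X" for A x
  proof -
    note fx = cmp_hom[OF x f(2)]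
    have "(x, s \<cdot> (f \<cdot> x)) \<in> hom_relation C X (kernel f) A" "(s \<cdot> (f \<cdot> x), x) \<in> hom_relation C X (kernel f) A"
      using x cmp_hom[OF fx s(1)] fs[OF fx] by (auto simp: hom_relation_kernel[OF f(2)])
    then show "(x, s \<cdot> (f \<cdot> x)) \<in> hom_relation C X Q A" "(s \<cdot> (f \<cdot> x), x) \<in> hom_relation C X Q A"
      using ker rX[OF equivalence_class[OF kernel_equivalence[OF f(2)]]] rX[OF Q]
      by (auto simp: subobject_le_iff[OF X])
  qed
  have "(x, y) \<in> hom_relation C X (inverse_image C f S) A \<longleftrightarrow> (x, y) \<in> hom_relation C X Q A" for A x y
  proof
    assume "(x, y) \<in> hom_relation C X (inverse_image C f S) A"
    then have "x \<in> hom C A X" "y \<in> hom C A X" "(s \<cdot> (f \<cdot> x), s \<cdot> (f \<cdot> y)) \<in> hom_relation C X Q A"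
      by (auto simp: IS(2) IQ(2))
    then show "(x, y) \<in> hom_relation C X Q A"
      using kerQ D(3) by blast
  next
    assume xy: "(x, y) \<in> hom_relation C X Q A"
    note h = hom_relation_hom[OF X rX[OF Q] xy]
    have "(s \<cdot> (f \<cdot> x), s \<cdot> (f \<cdot> y)) \<in> hom_relation C X Q A"
      using kerQ[OF h(1)] kerQ[OF h(2)] xy D(3) by blast
    then show "(x, y) \<in> hom_relation C X (inverse_image C f S) A"
      using h cmp_hom[OF h(1) f(2)] cmp_hom[OF h(2) f(2)] by (simp add: IS(2) IQ(2))
  qed
  then have "inverse_image C f S = Q"
    by (intro subobject_le_antisym[OF IS(1) rX[OF Q]])
      (auto simp: subobject_le_iff[OF X IS(1) rX[OF Q]] subobject_le_iff[OF X rX[OF Q] IS(1)])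
  then show "\<exists>S\<in>K Y. inverse_image C f S = Q"
    using S by blast
qed

lemma cocartesian_above_regular_epi:
  assumes reg: "regular_category C"
    and descend: "\<And>S. S \<in> relations C Y \<Longrightarrow> inverse_image C f S \<in> K X \<Longrightarrow> S \<in> K Y"
    and sup: "has_supremum C (K X) (kernel f) T"
    and f: "regular_epi C f" "f \<in> hom C X Y" and T: "T \<in> K X"
  shows "has_cocartesian_above Rel C ground f (X, T)"
proof (rule cocartesian_above_if_supremum[OF sup f(2) T])
  interpret regular_category C
    by (rule reg)
  note X = homD(4)[OF f(2)] and Y = homD(5)[OF f(2)]
  show "subobject_le C S W" if "S \<in> K Y" "W \<in> K Y"
    "subobject_le C (inverse_image C f S) (inverse_image C f W)" for S W
    using subobject_le_descend[OF f] class_rel[OF Y] that by blast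
  fix Q assume Q: "Q \<in> K X" and "subobject_le C (kernel f) Q"
  then obtain S where "S \<in> relations C Y" "inverse_image C f S = Q"
    using saturated_is_inverse_image[OF f class_preorder[OF Q]] by blast
  then show "\<exists>S\<in>K Y. inverse_image C f S = Q"
    using descend Q by blast
qed

lemma cocartesian_above_split_epis_iff_suprema:
  "(\<forall>f T. split_epi C f \<and> T \<in> obj Rel \<and> fobj ground T = src C f \<longrightarrow>
      has_cocartesian_above Rel C ground f T) \<longleftrightarrow>
    (\<forall>X\<in>obj C. \<forall>R\<in>equivalence_rels C X. \<forall>S\<in>K X. has_supremum C (K X) R S)"
proof (intro iffI ballI allI impI)
  fix X R S
  assume "\<forall>f T. split_epi C f \<and> T \<in> obj Rel \<and> fobj ground T = src C f \<longrightarrow>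
      has_cocartesian_above Rel C ground f T"
    and "X \<in> obj C" "R \<in> equivalence_rels C X" "S \<in> K X"
  then show "has_supremum C (K X) R S"
    by (intro supremum_if_cocartesian_above_split_epis) auto
next
  fix f T
  assume sup: "\<forall>X\<in>obj C. \<forall>R\<in>equivalence_rels C X. \<forall>S\<in>K X. has_supremum C (K X) R S"
    and fT: "split_epi C f \<and> T \<in> obj Rel \<and> fobj ground T = src C f"
  then obtain R where T: "T = (src C f, R)" "src C f \<in> obj C" "R \<in> K (src C f)"
    by (cases T) (auto simp: Rel_obj Rel_sel)
  have f: "f \<in> hom C (src C f) (tgt C f)"
    using fT arr_hom by (auto simp: split_epi_def)
  show "has_cocartesian_above Rel C ground f T"
    unfolding T(1) using sup T kernel_equivalence[OF f] fT f by (intro cocartesian_above_split_epi) auto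
qed

lemma cocartesian_above_regular_epis_iff_suprema:
  assumes reg: "regular_category C"
    and descend: "\<And>f X Y S. regular_epi C f \<Longrightarrow> f \<in> hom C X Y \<Longrightarrow> S \<in> relations C Y \<Longrightarrow>
      inverse_image C f S \<in> K X \<Longrightarrow> S \<in> K Y"
  shows "(\<forall>f T. regular_epi C f \<and> T \<in> obj Rel \<and> fobj ground T = src C f \<longrightarrow>
      has_cocartesian_above Rel C ground f T) \<longleftrightarrow>
    (\<forall>X\<in>obj C. \<forall>R\<in>equivalence_rels C X. \<forall>S\<in>K X. has_supremum C (K X) R S)"
proof (intro iffI allI impI)
  assume "\<forall>f T. regular_epi C f \<and> T \<in> obj Rel \<and> fobj ground T = src C f \<longrightarrow>
      has_cocartesian_above Rel C ground f T"
  then show "\<forall>X\<in>obj C. \<forall>R\<in>equivalence_rels C X. \<forall>S\<in>K X. has_supremum C (K X) R S"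
    using split_epi_regular_epi unfolding cocartesian_above_split_epis_iff_suprema[symmetric] by blast
next
  fix f T
  assume sup: "\<forall>X\<in>obj C. \<forall>R\<in>equivalence_rels C X. \<forall>S\<in>K X. has_supremum C (K X) R S"
    and fT: "regular_epi C f \<and> T \<in> obj Rel \<and> fobj ground T = src C f"
  then obtain R where T: "T = (src C f, R)" "src C f \<in> obj C" "R \<in> K (src C f)"
    by (cases T) (auto simp: Rel_obj Rel_sel)
  have f: "f \<in> hom C (src C f) (tgt C f)"
    using fT arr_hom by (auto simp: regular_epi_def is_coequalizer_def)
  show "has_cocartesian_above Rel C ground f T"
    unfolding T(1) using sup T kernel_equivalence[OF f] fT f descend[of f]
    by (intro cocartesian_above_regular_epi[OF reg]) auto
qed

end

theorem theorem2p1: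
  fixes E :: "('o, 'a) cat"
  assumes "finitely_complete E"
  shows
    "((\<forall>f T. split_epi E f \<and> T \<in> obj (PrO E) \<and> fobj ground T = src E f \<longrightarrow>
          has_cocartesian_above (PrO E) E ground f T) \<longleftrightarrow>
        (\<forall>X\<in>obj E. \<forall>R\<in>equivalence_rels E X. \<forall>S\<in>preorder_rels E X.
          has_supremum E (preorder_rels E X) R S)) \<and>
     ((\<forall>f T. split_epi E f \<and> T \<in> obj (Equ E) \<and> fobj ground T = src E f \<longrightarrow>
          has_cocartesian_above (Equ E) E ground f T) \<longleftrightarrow>
        (\<forall>X\<in>obj E. \<forall>R\<in>equivalence_rels E X. \<forall>S\<in>equivalence_rels E X.
          has_supremum E (equivalence_rels E X) R S)) \<and>
     (regular_category E \<longrightarrow>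
       ((\<forall>f T. regular_epi E f \<and> T \<in> obj (PrO E) \<and> fobj ground T = src E f \<longrightarrow>
            has_cocartesian_above (PrO E) E ground f T) \<longleftrightarrow>
          (\<forall>X\<in>obj E. \<forall>R\<in>equivalence_rels E X. \<forall>S\<in>preorder_rels E X.
            has_supremum E (preorder_rels E X) R S)) \<and>
       ((\<forall>f T. regular_epi E f \<and> T \<in> obj (Equ E) \<and> fobj ground T = src E f \<longrightarrow>
            has_cocartesian_above (Equ E) E ground f T) \<longleftrightarrow>
          (\<forall>X\<in>obj E. \<forall>R\<in>equivalence_rels E X. \<forall>S\<in>equivalence_rels E X.
            has_supremum E (equivalence_rels E X) R S)))"
proof -
  interpret finitely_complete E
    by (rule assms)
  interpret P: relation_class E "preorder_rels E"
    by unfold_locales (auto simp: equivalence_rels_def inverse_image_preorder)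
  have "equivalence_rels E X \<subseteq> preorder_rels E X" for X
    by (auto simp: equivalence_rels_def)
  then interpret Q: relation_class E "equivalence_rels E"
    by unfold_locales (use inverse_image_equivalence in auto)
  show ?thesis
  proof (intro conjI impI)
    assume reg: "regular_category E"
    note descend = regular_category.preorder_descend[OF reg]
      regular_category.equivalence_descend[OF reg]
    show "(\<forall>f T. regular_epi E f \<and> T \<in> obj (PrO E) \<and> fobj ground T = src E f \<longrightarrow>
          has_cocartesian_above (PrO E) E ground f T) \<longleftrightarrow>
        (\<forall>X\<in>obj E. \<forall>R\<in>equivalence_rels E X. \<forall>S\<in>preorder_rels E X.
          has_supremum E (preorder_rels E X) R S)"
      unfolding PrO_def by (rule P.cocartesian_above_regular_epis_iff_suprema[OF reg descend(1)])
    show "(\<forall>f T. regular_epi E f \<and> T \<in> obj (Equ E) \<and> fobj ground T = src E f \<longrightarrow>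
          has_cocartesian_above (Equ E) E ground f T) \<longleftrightarrow>
        (\<forall>X\<in>obj E. \<forall>R\<in>equivalence_rels E X. \<forall>S\<in>equivalence_rels E X.
          has_supremum E (equivalence_rels E X) R S)"
      unfolding Equ_def by (rule Q.cocartesian_above_regular_epis_iff_suprema[OF reg descend(2)])
  qed (use P.cocartesian_above_split_epis_iff_suprema Q.cocartesian_above_split_epis_iff_suprema
      in \<open>simp_all add: PrO_def Equ_def\<close>)
qed

end
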